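(* Let $E$ be a symmetric Banach function space on $\mathbf{R}^+=[0,\infty)$. Then $E$ satisfies a lower $q$-estimate for some $1<q<\infty$ if and only if there is an equivalent symmetric norm $\|\cdot\|_0$ on $E$ such that $(E,\|\cdot\|_0)$ has the uniform Kadec-Klee-Huff property with respect to local convergence in measure.
   Context: For a measurable function $f$ on $\mathbf{R}^+$, $\mu(f)$ denotes the right-continuous decreasing rearrangement of $|f|$ with respect to Lebesgue measure: $\mu_t(f)=\inf\{s\ge 0:|\{|f|>s\}|\le t\}$. A symmetric Banach function space on $\mathbf{R}^+$ is a Banach lattice $E$ of (complex) Lebesgue measurable functions on $\mathbf{R}^+$ such that (i) $E$ is an order ideal in the space $L^0(\mathbf{R}^+)$ of all finite a.e. measurable functions; (ii) if $x\in E$ and $y$ is measurable with $\mu(y)=\mu(x)$, then $y\in E$ and $\|y\|_E=\|x\|_E$; (iii) $E$ contains all finitely supported simple functions (those with support of finite measure). An equivalent symmetric norm on $E$ is an equivalent norm under which $E$, with the same order, is again a symmetric Banach function space. $E$ satisfies a lower $q$-estimate if there is a constant $C>0$ such that $(\sum\|x_n\|_E^q)^{1/q}\le C\|\sum x_n\|_E$ for all finite sequences $(x_n)$ of mutually disjoint elements of $E$. Local convergence in measure in $E$ means convergence in measure on every measurable subset of $\mathbf{R}^+$ of finite Lebesgue measure. A normed space $(E,\|\cdot\|)$ of this type has the uniform Kadec-Klee-Huff property with respect to local convergence in measure if for every $\epsilon>0$ there exists $\delta\in(0,1)$ such that whenever $(x_n)$ is a sequence in the closed unit ball of $(E,\|\cdot\|)$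 with $x_n\to x\in E$ locally in measure and $\|x\|>1-\delta$, there is a positive integer $N$ with $\sup_{n,m\ge N}\|x_n-x_m\|\le\epsilon$. *)

theory Defs
  imports "HOL-Analysis.Analysis"
begin

(* Functions on [0, \<infinity>) are represented by total functions real => complex, and a function
   space by the set of all representatives of its elements; two representatives stand for the
   same element iff they agree almost everywhere with respect to half_line. *)

abbreviation half_line :: "real measure" where
  "half_line \<equiv> lebesgue_on {0..}"

(* The infimum is taken in [0, \<infinity>], so that it is \<infinity> if no s is admissible. *)
definition decr_rearr :: "(real \<Rightarrow> complex) \<Rightarrow> real \<Rightarrow> ennreal" where
  "decr_rearr f t =
     (INF s \<in> {s::real. 0 \<le> s \<and>
        emeasure half_line {u \<in> space half_line. cmod (f u) > s} \<le> ennreal t}. ennreal s)"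

(* E is a linear space of (classes of) functions with norm N; N is unconstrained off E.
   The axiom ideal expresses both that E is an order ideal of L^0 and that N is a lattice norm.
   In particular E and N respect equality almost everywhere. *)
locale symmetric_banach_function_space =
  fixes E :: "(real \<Rightarrow> complex) set" and N :: "(real \<Rightarrow> complex) \<Rightarrow> real"
  assumes measurable: "x \<in> E \<Longrightarrow> x \<in> borel_measurable half_line"
    and add_closed: "x \<in> E \<Longrightarrow> y \<in> E \<Longrightarrow> (\<lambda>t. x t + y t) \<in> E"
    and scale_closed: "x \<in> E \<Longrightarrow> (\<lambda>t. c * x t) \<in> E"
    and norm_nonneg: "x \<in> E \<Longrightarrow> 0 \<le> N x"
    and norm_eq_0_iff: "x \<in> E \<Longrightarrow> N x = 0 \<longleftrightarrow> (AE t in half_line. x t = 0)"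
    and norm_scale: "x \<in> E \<Longrightarrow> N (\<lambda>t. c * x t) = cmod c * N x"
    and norm_triangle: "x \<in> E \<Longrightarrow> y \<in> E \<Longrightarrow> N (\<lambda>t. x t + y t) \<le> N x + N y"
    and complete:
      "\<And>X :: nat \<Rightarrow> real \<Rightarrow> complex. \<lbrakk>\<And>n. X n \<in> E;
        \<And>e. e > 0 \<Longrightarrow> \<exists>K. \<forall>m\<ge>K. \<forall>n\<ge>K. N (\<lambda>t. X m t - X n t) < e\<rbrakk>
       \<Longrightarrow> \<exists>x\<in>E. (\<lambda>n. N (\<lambda>t. X n t - x t)) \<longlonglongrightarrow> 0"
    and ideal:
      "\<lbrakk>x \<in> E; y \<in> borel_measurable half_line; AE t in half_line. cmod (y t) \<le> cmod (x t)\<rbrakk>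
       \<Longrightarrow> y \<in> E \<and> N y \<le> N x"
    and symmetric:
      "\<lbrakk>x \<in> E; y \<in> borel_measurable half_line; \<And>t. 0 \<le> t \<Longrightarrow> decr_rearr y t = decr_rearr x t\<rbrakk>
       \<Longrightarrow> y \<in> E \<and> N y = N x"
    and simple_mem:
      "\<lbrakk>simple_function half_line x; emeasure half_line {t \<in> space half_line. x t \<noteq> 0} < \<infinity>\<rbrakk>
       \<Longrightarrow> x \<in> E"

definition equivalent_norms ::
  "(real \<Rightarrow> complex) set \<Rightarrow> ((real \<Rightarrow> complex) \<Rightarrow> real) \<Rightarrow> ((real \<Rightarrow> complex) \<Rightarrow> real) \<Rightarrow> bool" where
  "equivalent_norms E N N' \<longleftrightarrow> (\<exists>a>0. \<exists>b>0. \<forall>x\<in>E. a * N x \<le> N' x \<and> N' x \<le> b * N x)"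

definition lower_estimate ::
  "(real \<Rightarrow> complex) set \<Rightarrow> ((real \<Rightarrow> complex) \<Rightarrow> real) \<Rightarrow> real \<Rightarrow> bool" where
  "lower_estimate E N q \<longleftrightarrow>
     (\<exists>C>0. \<forall>(n::nat) (x :: nat \<Rightarrow> real \<Rightarrow> complex).
        (\<forall>i<n. x i \<in> E) \<and>
        (\<forall>i<n. \<forall>j<n. i \<noteq> j \<longrightarrow> (AE t in half_line. x i t = 0 \<or> x j t = 0)) \<longrightarrow>
        (\<Sum>i<n. N (x i) powr q) powr (1 / q) \<le> C * N (\<lambda>t. \<Sum>i<n. x i t))"

definition tendsto_locally_in_measure ::
  "(nat \<Rightarrow> real \<Rightarrow> complex) \<Rightarrow> (real \<Rightarrow> complex) \<Rightarrow> bool" where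
  "tendsto_locally_in_measure X x \<longleftrightarrow>
     (\<forall>A \<in> sets half_line. emeasure half_line A < \<infinity> \<longrightarrow>
        (\<forall>e>0. (\<lambda>n. emeasure half_line {t \<in> A. cmod (X n t - x t) > e}) \<longlonglongrightarrow> 0))"

definition uniform_Kadec_Klee_Huff ::
  "(real \<Rightarrow> complex) set \<Rightarrow> ((real \<Rightarrow> complex) \<Rightarrow> real) \<Rightarrow> bool" where
  "uniform_Kadec_Klee_Huff E N \<longleftrightarrow>
     (\<forall>e>0. \<exists>d. 0 < d \<and> d < 1 \<and>
        (\<forall>X x. (\<forall>n. X n \<in> E \<and> N (X n) \<le> 1) \<and> x \<in> E \<and>
           tendsto_locally_in_measure X x \<and> N x > 1 - d \<longrightarrow>
           (\<exists>K. \<forall>n\<ge>K. \<forall>m\<ge>K. N (\<lambda>t. X n t - X m t) \<le> e)))"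

end

(* Both directions reduce to norms of restrictions of a single function to disjoint sets.

   If E satisfies a lower q-estimate, let N0 x be the supremum of (sum N(x 1_{A_i})^q)^(1/q) over
   finite disjoint families of measurable sets A_i. Minkowski's inequality makes N0 a norm, and
   N0 satisfies the lower q-estimate with constant 1 for a splitting x = x 1_P + x 1_{-P}. It is
   symmetric because the norm is order continuous and a partition of the level sets of a step
   function can be copied to those of an equimeasurable one, Lebesgue measure being nonatomic.
   If X_n tends to x locally in measure and N0 x > 1 - d, then X_n is norm close to x on sets B_n
   that carry almost all of the norm of x, so that the constant 1 forces N0(X_n 1_{-B_n}) to be
   small.

   Conversely, let z = x + y with disjoint x and y. Spreading copies of x and y over pairwise
   disjoint parts A_0, A_1, ... of the half line gives functions x_0 + y_n equimeasurable with z that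
   tend to x_0 locally in measure but are at mutual distance at least N y. Hence N y > N z / 2 forces
   N x <= (1 - d) N z. Removing pieces one at a time, there is a k such that k disjoint pieces of
   norm at least a have a sum of norm at least 2 a. Iterating, k^j pieces give 2^j a, which bounds
   the number of pieces of each dyadic size and yields a lower q-estimate with 2^q = 2 k. *)

theory Submission
  imports Defs
begin

subsection \<open>Restrictions and distribution functions\<close>

text \<open>All estimates concern pieces \<open>cut x A\<close> of one function, with
  \<open>A\<close> a Lebesgue subset of the whole line, so that complements are at hand. Order
  continuity is not among the axioms: the lower estimate and completeness supply it, and with it the
  finite measure of the sets where |x| > s > 0. The constant 1 is the purpose of the renorming. With
  a larger constant, a piece carrying nearly all of the norm would still allow a remainder that is
  not small. Symmetry is the obstacle, because \<open>N0\<close> is built from sets attached to one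
  particular function. Equimeasurable functions need not be linked by a measure preserving map of
  the half line: one may be positive everywhere while the other vanishes on a set of infinite
  measure. Hence only the levels of a step function above 0 are copied, and only their measures are
  compared. The choice 2^q = 2 k makes k^(j+1) pieces of norm at most 2^(-j) contribute at most k
  2^(-j) to the sum of q-th powers, which is the term of a convergent geometric series.\<close>

definition cut :: "(real \<Rightarrow> complex) \<Rightarrow> real set \<Rightarrow> real \<Rightarrow> complex" where
  "cut x A t = (if t \<in> A then x t else 0)"

lemma cut_cut [simp]: "cut (cut x A) B = cut x (A \<inter> B)"
  by (auto simp: cut_def)

lemma cut_UNIV [simp]: "cut x UNIV = x"
  by (auto simp: cut_def)

lemma cut_measurable [measurable]:
  assumes [measurable]: "x \<in> borel_measurable half_line" and A: "A \<in> sets lebesgue"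
  shows "cut x A \<in> borel_measurable half_line"
proof -
  have [measurable]: "{t \<in> space half_line. t \<in> A} \<in> sets half_line"
  proof -
    have "{t \<in> space half_line. t \<in> A} = A \<inter> {0..}" by auto
    moreover have "{0..} \<in> sets (lebesgue :: real measure)" by simp
    ultimately show ?thesis using A by (simp add: sets_restrict_space_iff sets.Int)
  qed
  show ?thesis
    unfolding cut_def by measurable
qed

lemma sets_half_line_lebesgue: "A \<in> sets half_line \<Longrightarrow> A \<in> sets lebesgue"
  by (auto simp: sets_restrict_space_iff)

lemma AE_half_lineI: "(\<And>t. 0 \<le> t \<Longrightarrow> P t) \<Longrightarrow> AE t in half_line. P t"
  by (rule AE_I2) simp

section \<open>Distribution functions and decreasing rearrangements\<close>

definition distribution_function :: "(real \<Rightarrow> complex) \<Rightarrow> real \<Rightarrow> ennreal" where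
  "distribution_function f s = emeasure half_line {u \<in> space half_line. cmod (f u) > s}"

lemma superlevel_set_measurable:
  assumes [measurable]: "f \<in> borel_measurable half_line"
  shows "{u. 0 \<le> u \<and> s < cmod (f u)} \<in> sets half_line"
proof -
  have "{u \<in> space half_line. s < cmod (f u)} \<in> sets half_line" by measurable
  then show ?thesis by simp
qed

text \<open>Continuity of the measure from below along the sets where |f| > s + 1/(n+1). It is the
  reason why the infimum in \<open>decr_rearr\<close> is attained when it is finite.\<close>

lemma distribution_function_right_continuous:
  assumes [measurable]: "f \<in> borel_measurable half_line"
    and le: "\<And>s'. s < s' \<Longrightarrow> distribution_function f s' \<le> c"
  shows "distribution_function f s \<le> c"
proof -
  let ?A = "\<lambda>n::nat. {u \<in> space half_line. cmod (f u) > s + 1 / Suc n}"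
  have "(SUP n. emeasure half_line (?A n)) = emeasure half_line (\<Union>n. ?A n)"
  proof (rule SUP_emeasure_incseq)
    show "incseq ?A"
    proof (rule incseq_SucI, clarify)
      fix n u assume "s + 1 / real (Suc n) < cmod (f u)"
      moreover have "1 / real (Suc (Suc n)) \<le> 1 / real (Suc n)"
        by (simp add: divide_simps)
      ultimately show "s + 1 / real (Suc (Suc n)) < cmod (f u)" by linarith
    qed
  qed (use superlevel_set_measurable[OF assms(1)] in auto)
  also have "(\<Union>n. ?A n) = {u \<in> space half_line. cmod (f u) > s}"
  proof (intro equalityI subsetI)
    fix u assume "u \<in> {u \<in> space half_line. s < cmod (f u)}"
    then have u: "u \<in> space half_line" "cmod (f u) - s > 0" by auto
    then obtain n where "1 / real (Suc n) < cmod (f u) - s"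
      using reals_Archimedean by (metis inverse_eq_divide)
    with u show "u \<in> (\<Union>n. ?A n)" by (auto simp: algebra_simps)
  next
    fix u assume "u \<in> (\<Union>n. ?A n)"
    then obtain n where "u \<in> space half_line" "s + 1 / real (Suc n) < cmod (f u)" by auto
    moreover have "s < s + 1 / real (Suc n)" by simp
    ultimately have "u \<in> space half_line" "s < cmod (f u)" by linarith+
    then show "u \<in> {u \<in> space half_line. s < cmod (f u)}" by simp
  qed
  finally have "distribution_function f s = (SUP n. emeasure half_line (?A n))"
    unfolding distribution_function_def by (rule sym)
  also have "\<dots> \<le> c"
  proof (rule SUP_least)
    fix n show "emeasure half_line (?A n) \<le> c"
      using le[of "s + 1 / Suc n"] unfolding distribution_function_def by simp
  qed
  finally show ?thesis .
qed

text \<open>The two functions are generalised inverses of each other. A bound s on the infimum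
  yields admissible levels below every s' > s only; right continuity then reaches s itself.\<close>

lemma decr_rearr_le_iff:
  assumes f: "f \<in> borel_measurable half_line" and "0 \<le> s"
  shows "decr_rearr f t \<le> ennreal s \<longleftrightarrow> distribution_function f s \<le> ennreal t"
proof
  assume "distribution_function f s \<le> ennreal t"
  then show "decr_rearr f t \<le> ennreal s"
    unfolding decr_rearr_def distribution_function_def using \<open>0 \<le> s\<close> by (intro INF_lower) auto
next
  assume le: "decr_rearr f t \<le> ennreal s"
  show "distribution_function f s \<le> ennreal t"
  proof (rule distribution_function_right_continuous[OF f])
    fix s' assume "s < s'"
    then have "decr_rearr f t < ennreal s'"
      using le \<open>0 \<le> s\<close> by (metis ennreal_lessI leD le_less_trans less_eq_real_def not_le)
    then obtain r where r: "0 \<le> r" "distribution_function f r \<le> ennreal t" "ennreal r < ennreal s'"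
      unfolding decr_rearr_def distribution_function_def by (auto simp: INF_less_iff)
    have "r < s'" using r by (meson ennreal_leI leI not_le)
    then have "distribution_function f s' \<le> distribution_function f r"
      unfolding distribution_function_def using superlevel_set_measurable[OF f] by (intro emeasure_mono) auto
    then show "distribution_function f s' \<le> ennreal t" using r by simp
  qed
qed

text \<open>Turns the axiom \<open>symmetric\<close> into a statement about distribution functions,
  the form in which symmetry is used from here on.\<close>

lemma decr_rearr_eq_iff:
  assumes f: "f \<in> borel_measurable half_line" and g: "g \<in> borel_measurable half_line"
  shows "(\<forall>t\<ge>0. decr_rearr f t = decr_rearr g t) \<longleftrightarrow>
    (\<forall>s\<ge>0. distribution_function f s = distribution_function g s)"
proof
  assume eq: "\<forall>s\<ge>0. distribution_function f s = distribution_function g s"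
  have "{s. 0 \<le> s \<and> distribution_function f s \<le> ennreal t} = {s. 0 \<le> s \<and> distribution_function g s \<le> ennreal t}" for t
    by (rule Collect_cong, rule conj_cong) (simp_all add: eq)
  then show "\<forall>t\<ge>0. decr_rearr f t = decr_rearr g t"
    unfolding decr_rearr_def distribution_function_def[symmetric] by simp
next
  assume eq: "\<forall>t\<ge>0. decr_rearr f t = decr_rearr g t"
  show "\<forall>s\<ge>0. distribution_function f s = distribution_function g s"
  proof (intro allI impI)
    fix s :: real assume "0 \<le> s"
    \<comment> \<open>An element of [0, \<infinity>] is determined by its finite upper bounds, and
      these are exactly the values that \<open>t\<close> can take; the bound \<infinity> is
      trivial.\<close>
    have le: "distribution_function f s \<le> c \<longleftrightarrow> distribution_function g s \<le> c" for c
    proof (cases c)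
      case (real r)
      then have "decr_rearr f r \<le> ennreal s \<longleftrightarrow> decr_rearr g r \<le> ennreal s" using eq by simp
      then show ?thesis
        using decr_rearr_le_iff[OF f \<open>0 \<le> s\<close>, of r] decr_rearr_le_iff[OF g \<open>0 \<le> s\<close>, of r] real(2) by blast
    qed simp
    show "distribution_function f s = distribution_function g s"
      by (rule antisym[OF iffD2[OF le order_refl] iffD1[OF le order_refl]])
  qed
qed

text \<open>The lower estimate for the pieces of a single function. Powers stand on both sides, so
  that no root is involved when block sums are added or their supremum is taken. For q > 1 it is
  equivalent to \<open>lower_estimate\<close> up to the constant.\<close>

definition lower_set_estimate ::
  "(real \<Rightarrow> complex) set \<Rightarrow> ((real \<Rightarrow> complex) \<Rightarrow> real) \<Rightarrow> real \<Rightarrow> real \<Rightarrow> bool" where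
  "lower_set_estimate E N q C \<longleftrightarrow>
     (\<forall>(n::nat) A x. x \<in> E \<and> (\<forall>i<n. A i \<in> sets lebesgue) \<and> disjoint_family_on A {..<n} \<longrightarrow>
       (\<Sum>i<n. N (cut x (A i)) powr q) \<le> C * N x powr q)"

lemma lower_set_estimateD:
  fixes n :: nat
  assumes "lower_set_estimate E N q C" "x \<in> E"
    "\<And>i. i < n \<Longrightarrow> A i \<in> sets lebesgue" "disjoint_family_on A {..<n}"
  shows "(\<Sum>i<n. N (cut x (A i)) powr q) \<le> C * N x powr q"
  using assms unfolding lower_set_estimate_def by blast

context symmetric_banach_function_space
begin

lemma norm_mono:
  assumes "x \<in> E" "y \<in> borel_measurable half_line" "\<And>t. 0 \<le> t \<Longrightarrow> cmod (y t) \<le> cmod (x t)"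
  shows "y \<in> E" "N y \<le> N x"
  using ideal[of x y] assms by (auto intro: AE_half_lineI)

lemma cut_mem: "x \<in> E \<Longrightarrow> A \<in> sets lebesgue \<Longrightarrow> cut x A \<in> E"
  by (rule norm_mono) (auto intro: cut_measurable measurable simp: cut_def)

lemma norm_cut_mono:
  assumes "x \<in> E" "A \<in> sets lebesgue" "B \<in> sets lebesgue" "\<And>t. t \<in> A \<Longrightarrow> 0 \<le> t \<Longrightarrow> t \<in> B"
  shows "N (cut x A) \<le> N (cut x B)"
  by (rule norm_mono) (use assms in \<open>auto intro: cut_measurable measurable cut_mem simp: cut_def\<close>)

lemma norm_cut_le: "x \<in> E \<Longrightarrow> A \<in> sets lebesgue \<Longrightarrow> N (cut x A) \<le> N x"
  using norm_cut_mono[of x A UNIV] by simp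

lemma norm_cong_AE:
  assumes "x \<in> E" "y \<in> borel_measurable half_line" "AE t in half_line. y t = x t"
  shows "y \<in> E" "N y = N x"
proof -
  have "AE t in half_line. cmod (y t) \<le> cmod (x t)" "AE t in half_line. cmod (x t) \<le> cmod (y t)"
    using assms(3) by (eventually_elim, simp)+
  then have y: "y \<in> E" "N y \<le> N x" and le: "AE t in half_line. cmod (x t) \<le> cmod (y t)"
    using ideal[of x y] assms by auto
  moreover have "N x \<le> N y"
    using ideal[of y x] y(1) le assms measurable by auto
  ultimately show "y \<in> E" "N y = N x" by auto
qed

lemma equimeasurable:
  assumes "x \<in> E" "y \<in> borel_measurable half_line"
    "\<And>s. 0 \<le> s \<Longrightarrow> distribution_function y s = distribution_function x s"
  shows "y \<in> E" "N y = N x"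
  using symmetric[OF assms(1,2)] decr_rearr_eq_iff[OF assms(2) measurable[OF assms(1)]] assms(3) by auto

lemma minus_closed: "x \<in> E \<Longrightarrow> y \<in> E \<Longrightarrow> (\<lambda>t. x t - y t) \<in> E"
  using add_closed[OF _ scale_closed[of y "-1"]] by simp

lemma norm_minus_commute: "x \<in> E \<Longrightarrow> y \<in> E \<Longrightarrow> N (\<lambda>t. x t - y t) = N (\<lambda>t. y t - x t)"
  using norm_scale[of "\<lambda>t. x t - y t" "-1"] minus_closed[of x y] by simp

lemma norm_triangle_minus:
  assumes "x \<in> E" "y \<in> E" "z \<in> E"
  shows "N (\<lambda>t. x t - z t) \<le> N (\<lambda>t. x t - y t) + N (\<lambda>t. y t - z t)"
  using norm_triangle[of "\<lambda>t. x t - y t" "\<lambda>t. y t - z t"] minus_closed assms by simp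

lemma norm_le_diff:
  assumes "x \<in> E" "y \<in> E"
  shows "N x \<le> N y + N (\<lambda>t. x t - y t)"
  using norm_triangle[of y "\<lambda>t. x t - y t"] minus_closed assms by simp

lemma lower_set_estimate_imp:
  assumes "lower_estimate E N q" "q > 1"
  obtains C where "C > 0" "lower_set_estimate E N q C"
proof -
  obtain C where "C > 0" and C: "\<And>n x. (\<forall>i<n. x i \<in> E) \<Longrightarrow>
        (\<forall>i<n. \<forall>j<n. i \<noteq> j \<longrightarrow> (AE t in half_line. x i t = 0 \<or> x j t = 0)) \<Longrightarrow>
        (\<Sum>i<(n::nat). N (x i) powr q) powr (1 / q) \<le> C * N (\<lambda>t. \<Sum>i<n. x i t)"
    using assms(1) unfolding lower_estimate_def by blast
  have "lower_set_estimate E N q (C powr q)"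
    unfolding lower_set_estimate_def
  proof (intro allI impI, elim conjE)
    fix n x and A :: "nat \<Rightarrow> real set" assume x: "x \<in> E" and A: "\<forall>i<n. A i \<in> sets lebesgue"
      and disj: "disjoint_family_on A {..<n::nat}"
    let ?S = "\<Sum>i<n. N (cut x (A i)) powr q"
    have "?S powr (1 / q) \<le> C * N (\<lambda>t. \<Sum>i<n. cut x (A i) t)"
      using A x disj
      by (intro C) (auto intro!: cut_mem AE_half_lineI simp: cut_def disjoint_family_on_def)
    also have "(\<lambda>t. \<Sum>i<n. cut x (A i) t) = cut x (\<Union>i<n. A i)"
    proof
      fix t show "(\<Sum>i<n. cut x (A i) t) = cut x (\<Union>i<n. A i) t"
      proof (cases "\<exists>i<n. t \<in> A i")
        case True
        then obtain i where i: "i < n" "t \<in> A i" by auto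
        have "(\<Sum>j<n. cut x (A j) t) = (\<Sum>j\<in>{i}. cut x (A j) t)"
          using i disj by (intro sum.mono_neutral_right) (auto simp: cut_def disjoint_family_on_def)
        then show ?thesis using i by (auto simp: cut_def)
      next
        case False
        then show ?thesis by (auto simp: cut_def intro!: sum.neutral)
      qed
    qed
    also have "N (cut x (\<Union>i<n. A i)) \<le> N x"
      using A x by (intro norm_cut_le) auto
    finally have "?S powr (1 / q) \<le> C * N x" using \<open>C > 0\<close> by simp
    then have "(?S powr (1 / q)) powr q \<le> (C * N x) powr q"
      using \<open>q > 1\<close> by (intro powr_mono2) auto
    moreover have "?S \<ge> 0" by (simp add: sum_nonneg)
    ultimately show "?S \<le> C powr q * N x powr q"
      using \<open>q > 1\<close> \<open>C > 0\<close> norm_nonneg[OF x] by (simp add: powr_powr powr_mult)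
  qed
  with \<open>C > 0\<close> show thesis by (intro that[of "C powr q"]) auto
qed

lemma sum_mem: "(\<And>i. i < n \<Longrightarrow> x i \<in> E) \<Longrightarrow> (\<lambda>t. \<Sum>i<n::nat. x i t) \<in> E"
proof (induction n)
  case 0
  show ?case by (rule simple_mem) auto
next
  case (Suc n)
  then show ?case using add_closed[of "\<lambda>t. \<Sum>i<n. x i t" "x n"] by simp
qed

text \<open>Disjoint functions are recovered, up to null sets, as pieces of their own sum
  \<open>z\<close>.\<close>

lemma lower_estimate_of_set:
  assumes est: "lower_set_estimate E N q C" and "C > 0" "q > 1"
  shows "lower_estimate E N q"
  unfolding lower_estimate_def
proof (intro exI[of _ "C powr (1/q)"] conjI allI impI, goal_cases)
  case 1
  then show ?case using \<open>C > 0\<close> by simp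
next
  case (2 n x)
  then have x: "\<And>i. i < n \<Longrightarrow> x i \<in> E"
    and disj: "\<And>i j. i < n \<Longrightarrow> j < n \<Longrightarrow> i \<noteq> j \<Longrightarrow> (AE t in half_line. x i t = 0 \<or> x j t = 0)"
    by auto
  define z where "z = (\<lambda>t. \<Sum>i<n. x i t)"
  have z: "z \<in> E" unfolding z_def by (rule sum_mem) (use x in auto)
  have [measurable]: "x i \<in> borel_measurable half_line" if "i < n" for i
    using x that measurable by auto
  \<comment> \<open>The supports are disjoint only almost everywhere. Points where another summand
    is non-zero are left out, which makes the sets truly disjoint and changes each
    \<open>x i\<close> on a null set only.\<close>
  define A where "A i = {t \<in> space half_line. x i t \<noteq> 0 \<and> (\<forall>j\<in>{..<n}-{i}. x j t = 0)}" for i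
  have "{t \<in> space half_line. x i t \<noteq> 0 \<and> (\<forall>j\<in>{..<n}-{i}. x j t = 0)} \<in> sets half_line" if "i < n" for i
  proof -
    have "{t \<in> space half_line. x j t = 0} \<in> sets half_line" if "j < n" for j
      using that by measurable
    then show ?thesis
      using that by (intro sets.sets_Collect sets.sets_Collect_finite_All) auto
  qed
  then have A: "A i \<in> sets lebesgue" if "i < n" for i
    using that sets_half_line_lebesgue unfolding A_def by blast
  have "N (cut z (A i)) = N (x i)" if i: "i < n" for i
  proof (rule norm_cong_AE)
    have "AE t in half_line. \<forall>j\<in>{..<n}-{i}. x i t = 0 \<or> x j t = 0"
      using disj i by (intro AE_finite_allI) auto
    then show "AE t in half_line. cut z (A i) t = x i t"
    proof (rule AE_mp, intro AE_I2 impI)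
      fix t assume t: "t \<in> space half_line" "\<forall>j\<in>{..<n}-{i}. x i t = 0 \<or> x j t = 0"
      show "cut z (A i) t = x i t"
      proof (cases "x i t = 0")
        case False
        have "z t = (\<Sum>j\<in>{i}. x j t)"
          unfolding z_def using i t False by (intro sum.mono_neutral_right) auto
        then show ?thesis using t False by (auto simp: cut_def A_def)
      qed (auto simp: cut_def A_def)
    qed
    show "x i \<in> E" using x i by simp
    show "cut z (A i) \<in> borel_measurable half_line" using z A i measurable cut_measurable by auto
  qed
  then have "(\<Sum>i<n. N (x i) powr q) = (\<Sum>i<n. N (cut z (A i)) powr q)" by simp
  also have "\<dots> \<le> C * N z powr q"
    using A by (intro lower_set_estimateD[OF est z]) (auto simp: A_def disjoint_family_on_def)
  finally have "(\<Sum>i<n. N (x i) powr q) powr (1 / q) \<le> (C * N z powr q) powr (1 / q)"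
    using \<open>q > 1\<close> by (intro powr_mono2) (auto simp: sum_nonneg)
  also have "\<dots> = C powr (1 / q) * N z"
    using \<open>q > 1\<close> \<open>C > 0\<close> norm_nonneg[OF z] by (simp add: powr_powr powr_mult)
  finally show ?case unfolding z_def .
qed

end

text \<open>A lower estimate survives an equivalent renorming, the constant growing by the factor
  (b/a)^q. This carries it from \<open>N\<close> to the new norm, and back to \<open>N\<close> from
  a norm with the Kadec-Klee-Huff property.\<close>

lemma lower_set_estimate_equivalent:
  assumes "symmetric_banach_function_space E N" "symmetric_banach_function_space E N'"
    and "equivalent_norms E N N'" and est: "lower_set_estimate E N q C" and "C > 0" "q > 0"
  shows "\<exists>C'>0. lower_set_estimate E N' q C'"
proof -
  interpret N: symmetric_banach_function_space E N by fact
  interpret N': symmetric_banach_function_space E N' by fact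
  obtain a b where ab: "a > 0" "b > 0" "\<And>x. x \<in> E \<Longrightarrow> a * N x \<le> N' x \<and> N' x \<le> b * N x"
    using assms(3) unfolding equivalent_norms_def by blast
  have "lower_set_estimate E N' q (b powr q * C * (1/a) powr q)"
    unfolding lower_set_estimate_def
  proof (intro allI impI, elim conjE)
    fix n x and A :: "nat \<Rightarrow> real set" assume x: "x \<in> E" and A: "\<forall>i<n. A i \<in> sets lebesgue"
      and disj: "disjoint_family_on A {..<n::nat}"
    have cut: "cut x (A i) \<in> E" if "i < n" for i using that A x by (auto intro: N.cut_mem)
    have "(\<Sum>i<n. N' (cut x (A i)) powr q) \<le> (\<Sum>i<n. b powr q * N (cut x (A i)) powr q)"
      using ab \<open>q > 0\<close> cut N.norm_nonneg N'.norm_nonneg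
      by (intro sum_mono) (auto simp: powr_mult[symmetric] intro!: powr_mono2)
    also have "\<dots> \<le> b powr q * (C * N x powr q)"
      unfolding sum_distrib_left[symmetric] using A disj
      by (intro mult_left_mono lower_set_estimateD[OF est x]) auto
    also have "\<dots> \<le> b powr q * (C * (1/a * N' x) powr q)"
    proof -
      have "N x \<le> 1/a * N' x" using ab(3)[OF x] ab(1) by (simp add: field_simps)
      then show ?thesis
        using \<open>C > 0\<close> \<open>q > 0\<close> N.norm_nonneg[OF x] by (intro mult_left_mono powr_mono2) auto
    qed
    also have "\<dots> = b powr q * C * (1/a) powr q * N' x powr q"
      using ab N'.norm_nonneg[OF x] by (subst powr_mult) auto
    finally show "(\<Sum>i<n. N' (cut x (A i)) powr q) \<le> b powr q * C * (1/a) powr q * N' x powr q" .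
  qed
  then show ?thesis using ab \<open>C > 0\<close> by (intro exI[of _ "b powr q * C * (1/a) powr q"]) auto
qed

lemma equivalent_norms_sym:
  assumes "equivalent_norms E N N'"
  shows "equivalent_norms E N' N"
proof -
  obtain a b where ab: "a > 0" "b > 0" "\<And>x. x \<in> E \<Longrightarrow> a * N x \<le> N' x \<and> N' x \<le> b * N x"
    using assms(1) unfolding equivalent_norms_def by blast
  show ?thesis unfolding equivalent_norms_def
    using ab by (intro exI[of _ "1/b"] exI[of _ "1/a"] conjI ballI) (auto simp: field_simps)
qed

subsection \<open>Order continuity\<close>

lemma multiples_unbounded:
  fixes e K :: real
  assumes "e > 0" "\<And>n::nat. real n * e \<le> K"
  shows False
proof -
  obtain n :: nat where "K / e < real n" using reals_Archimedean2 by blast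
  then have "K < real n * e" using assms(1) by (simp add: field_simps)
  then show False using assms(2)[of n] by simp
qed

lemma distribution_function_indicator:
  assumes "D \<in> sets half_line" "0 \<le> r"
  shows "distribution_function (cut (\<lambda>_. 1) D) r = (if r < 1 then emeasure half_line D else 0)"
proof -
  have "D \<subseteq> {0..}" using sets.sets_into_space[OF assms(1)] by simp
  then have "{u \<in> space half_line. cmod (cut (\<lambda>_. 1) D u) > r} = (if r < 1 then D else {})"
    using assms(2) by (auto simp: cut_def)
  then show ?thesis by (simp add: distribution_function_def)
qed

context symmetric_banach_function_space
begin

lemma indicator_mem:
  assumes "D \<in> sets half_line" "emeasure half_line D < \<infinity>"
  shows "cut (\<lambda>_. 1) D \<in> E"
proof (rule simple_mem)
  have sub: "D \<subseteq> {0..}" using sets.sets_into_space[OF assms(1)] by simp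
  show "simple_function half_line (cut (\<lambda>_. 1 :: complex) D)"
  proof (rule simple_function_borel_measurable)
    show "cut (\<lambda>_. 1 :: complex) D \<in> borel_measurable half_line"
      using sets_half_line_lebesgue[OF assms(1)] by measurable
    show "finite (cut (\<lambda>_. 1 :: complex) D ` space half_line)"
      by (rule finite_subset[of _ "{0, 1}"]) (auto simp: cut_def)
  qed
  have "{t \<in> space half_line. cut (\<lambda>_. 1 :: complex) D t \<noteq> 0} = D" using sub by (auto simp: cut_def)
  then show "emeasure half_line {t \<in> space half_line. cut (\<lambda>_. 1 :: complex) D t \<noteq> 0} < \<infinity>"
    using assms(2) by simp
qed

text \<open>Differences of the decreasing sets \<open>B\<close> are disjoint, so the lower estimate
  excludes infinitely many of them carrying norm at least \<open>e\<close>. Hence the restrictions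
  of \<open>x\<close> to the complements form a Cauchy sequence; completeness gives a limit, which
  has to be \<open>x\<close>.\<close>

lemma order_continuous:
  assumes est: "lower_set_estimate E N q C" and "q > 0" and x: "x \<in> E"
    and B: "\<And>k. B k \<in> sets lebesgue" "decseq B" "\<And>t. 0 \<le> t \<Longrightarrow> \<exists>k. t \<notin> B k"
  shows "(\<lambda>k. N (cut x (B k))) \<longlonglongrightarrow> 0"
proof -
  have mem: "cut x (A) \<in> E" if "A \<in> sets lebesgue" for A using cut_mem x that by blast
  have Bm: "B n \<subseteq> B m" if "m \<le> n" for m n using B(2) that by (auto simp: decseq_def)
  have diff: "(\<lambda>t. cut x (- B n) t - cut x (- B m) t) = cut x (B m - B n)" if "m \<le> n" for m n
    using Bm[OF that] by (auto simp: cut_def fun_eq_iff)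
  have cauchy: "\<exists>K. \<forall>n\<ge>K. N (cut x (B K - B n)) < e" if "e > 0" for e
  proof (rule ccontr)
    assume "\<not> ?thesis"
    then have "\<forall>K. \<exists>n\<ge>K. N (cut x (B K - B n)) \<ge> e" by (meson not_le)
    then obtain f where f: "\<And>K. f K \<ge> K" "\<And>K. N (cut x (B K - B (f K))) \<ge> e" by metis
    \<comment> \<open>Iterating \<open>f\<close> yields consecutive blocks
      \<open>B (s i) - B (s (Suc i))\<close>, which are pairwise disjoint and all of norm at least
      \<open>e\<close>.\<close>
    define s where "s i = (f ^^ i) 0" for i
    have s_Suc: "s (Suc i) = f (s i)" for i by (simp add: s_def)
    have s_mono: "s i \<le> s j" if "i \<le> j" for i j
      using lift_Suc_mono_le[of s, OF _ that] f(1) s_Suc by simp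
    have "real n * e powr q \<le> C * N x powr q" for n
    proof -
      have "real n * e powr q = (\<Sum>i<n. e powr q)" by simp
      also have "\<dots> \<le> (\<Sum>i<n. N (cut x (B (s i) - B (s (Suc i)))) powr q)"
        using f(2) \<open>e > 0\<close> \<open>q > 0\<close> unfolding s_Suc by (intro sum_mono powr_mono2) auto
      also have "\<dots> \<le> C * N x powr q"
      proof (rule lower_set_estimateD[OF est x])
        have "(B (s i) - B (s (Suc i))) \<inter> (B (s j) - B (s (Suc j))) = {}" if "i < j" for i j
          using Bm[OF s_mono[of "Suc i" j]] that by auto
        then show "disjoint_family_on (\<lambda>i. B (s i) - B (s (Suc i))) {..<n}"
          unfolding disjoint_family_on_def by (metis Int_commute linorder_neqE_nat)
      qed (use B(1) in auto)
      finally show ?thesis .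
    qed
    moreover have "e powr q > 0" using \<open>e > 0\<close> by simp
    ultimately show False using multiples_unbounded by blast
  qed
  have cauchy': "\<exists>K. \<forall>m\<ge>K. \<forall>n\<ge>K. N (\<lambda>t. cut x (- B m) t - cut x (- B n) t) < e" if e: "e > 0" for e
  proof -
    obtain K where K: "\<And>n. n \<ge> K \<Longrightarrow> N (cut x (B K - B n)) < e" using cauchy[OF e] by blast
    have less: "N (\<lambda>t. cut x (- B n) t - cut x (- B m) t) < e" if "K \<le> m" "m \<le> n" for m n
    proof -
      have "N (cut x (B m - B n)) \<le> N (cut x (B K - B n))"
        using Bm[OF that(1)] B(1) x by (intro norm_cut_mono) auto
      then show ?thesis using K[of n] that diff[OF that(2)] by simp
    qed
    have "N (\<lambda>t. cut x (- B m) t - cut x (- B n) t) < e" if "m \<ge> K" "n \<ge> K" for m n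
      using less[of m n] less[of n m] that B(1)
        norm_minus_commute[of "cut x (- B m)" "cut x (- B n)"] mem[of "- B m"] mem[of "- B n"]
      by (cases "m \<le> n") (auto simp: Compl_in_sets_lebesgue)
    then show ?thesis by blast
  qed
  have memB: "cut x (- B n) \<in> E" for n using B(1) by (intro mem) (simp add: Compl_in_sets_lebesgue)
  obtain z where z: "z \<in> E" and lim: "(\<lambda>n. N (\<lambda>t. cut x (- B n) t - z t)) \<longlonglongrightarrow> 0"
    using complete[of "\<lambda>n. cut x (- B n)", OF memB cauchy'] by auto
  \<comment> \<open>Identifies the norm limit: on the complement of \<open>B k\<close> every
    approximant with n \<ge> k already equals \<open>x\<close>, so \<open>x - z\<close> has norm 0
    there.\<close>
  have "AE t in half_line. t \<notin> B k \<longrightarrow> z t = x t" for k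
  proof -
    define y where "y = cut (\<lambda>t. x t - z t) (- B k)"
    have y: "y \<in> E" unfolding y_def
      using minus_closed[OF x z] B(1) by (intro cut_mem) (auto simp: Compl_in_sets_lebesgue)
    have "N y \<le> N (\<lambda>t. cut x (- B n) t - z t)" if "n \<ge> k" for n
      using Bm[OF that]
      by (intro norm_mono(2)[OF minus_closed[OF memB z] measurable[OF y]]) (auto simp: y_def cut_def)
    then have "N y \<le> 0"
      by (intro tendsto_lowerbound[OF lim]) (auto simp: eventually_sequentially)
    then have "AE t in half_line. y t = 0" using norm_eq_0_iff[OF y] norm_nonneg[OF y] by simp
    then show ?thesis by eventually_elim (auto simp: y_def cut_def)
  qed
  then have "AE t in half_line. \<forall>k. t \<notin> B k \<longrightarrow> z t = x t" by (subst AE_all_countable) auto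
  moreover have "AE t in half_line. \<exists>k. t \<notin> B k" using B(3) by (rule AE_half_lineI)
  ultimately have zx: "AE t in half_line. z t = x t" by eventually_elim auto
  have "N (cut x (B n)) = N (\<lambda>t. cut x (- B n) t - z t)" for n
  proof -
    have "N (cut x (B n)) = N (\<lambda>t. z t - cut x (- B n) t)"
    proof (rule norm_cong_AE)
      show "AE t in half_line. cut x (B n) t = z t - cut x (- B n) t"
        using zx by eventually_elim (auto simp: cut_def)
      show "cut x (B n) \<in> borel_measurable half_line" using mem[OF B(1)] measurable by blast
    qed (rule minus_closed[OF z memB])
    then show ?thesis using norm_minus_commute[OF z memB] by simp
  qed
  then show ?thesis using lim by simp
qed

text \<open>If S = {|x| > s} had infinite measure, its indicator would lie in \<open>E\<close>, and
  cutting off a bounded part [0, m) would leave an equimeasurable function. The norms of these tails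
  would be constant, whereas order continuity sends them to 0.\<close>

lemma distribution_function_finite:
  assumes est: "lower_set_estimate E N q C" and "q > 0" and x: "x \<in> E" and "s > 0"
  shows "distribution_function x s < \<infinity>"
proof (rule ccontr)
  assume "\<not> ?thesis"
  then have inf: "distribution_function x s = \<infinity>" by (simp add: less_top[symmetric])
  define S where "S = {u. 0 \<le> u \<and> s < cmod (x u)}"
  have S: "S \<in> sets half_line" unfolding S_def by (rule superlevel_set_measurable[OF measurable[OF x]])
  then have SL: "S \<in> sets lebesgue" by (rule sets_half_line_lebesgue)
  have infS: "emeasure half_line S = \<infinity>" using inf by (simp add: distribution_function_def S_def)
  let ?f = "cut (\<lambda>_. 1) S"
  have fE: "?f \<in> E"
  proof (rule norm_mono)
    show "(\<lambda>t. complex_of_real (1 / s) * x t) \<in> E" by (rule scale_closed[OF x])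
    show "?f \<in> borel_measurable half_line" using SL by measurable
    show "cmod (?f t) \<le> cmod (complex_of_real (1 / s) * x t)" for t
      using \<open>s > 0\<close> by (auto simp: cut_def S_def norm_mult norm_divide)
  qed
  have "(\<lambda>m. N (cut ?f {real m..})) \<longlonglongrightarrow> 0"
  proof (rule order_continuous[OF est \<open>q > 0\<close> fE])
    show "\<exists>k. t \<notin> {real k..}" for t using reals_Archimedean2[of t] by (auto simp: not_le)
  qed (auto simp: decseq_def)
  moreover have "N (cut ?f {real m..}) = N ?f" for m
  proof (rule equimeasurable)
    have S': "S \<inter> {real m..} \<in> sets half_line" and I: "{0..real m} \<in> sets half_line"
      using SL S by (auto simp: sets_restrict_space_iff)
    have "emeasure half_line S \<le> emeasure half_line ((S \<inter> {real m..}) \<union> {0..real m})"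
      using S' I by (intro emeasure_mono sets.Un) (auto simp: S_def)
    also have "\<dots> \<le> emeasure half_line (S \<inter> {real m..}) + emeasure half_line {0..real m}"
      using S' I by (rule emeasure_subadditive)
    also have "emeasure half_line {0..real m} = ennreal m" by (simp add: emeasure_restrict_space)
    finally have "emeasure half_line (S \<inter> {real m..}) = \<infinity>"
      using infS by (simp add: top_unique)
    then show "distribution_function (cut ?f {real m..}) r = distribution_function ?f r" if "0 \<le> r" for r
      using distribution_function_indicator[OF S that] distribution_function_indicator[OF S' that] infS by simp
    show "cut ?f {real m..} \<in> borel_measurable half_line" using measurable[OF cut_mem[OF fE, of "{real m..}"]] by simp
  qed (rule fE)
  ultimately have "N ?f = 0" by (simp add: LIMSEQ_const_iff)
  then have "AE t in half_line. ?f t = 0" using norm_eq_0_iff[OF fE] by simp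
  then have "AE t in half_line. t \<notin> S" by eventually_elim (auto simp: cut_def)
  then have "emeasure half_line S = 0" using AE_iff_null_sets[OF S] by auto
  then show False using infS by simp
qed

text \<open>The sets where both t and |x t| are at most n exhaust the half line, so order continuity
  makes the part of \<open>x\<close> outside them small.\<close>

lemma truncation:
  assumes est: "lower_set_estimate E N q C" and "q > 0" and x: "x \<in> E" and "e > 0"
  obtains A M where "A \<in> sets half_line" "emeasure half_line A < \<infinity>" "M > 0"
    "\<And>t. t \<in> A \<Longrightarrow> cmod (x t) \<le> M" "N (cut x (- A)) < e"
proof -
  define A where "A n = {t \<in> space half_line. t \<le> real n \<and> cmod (x t) \<le> real n}" for n
  have [measurable]: "x \<in> borel_measurable half_line" by (rule measurable[OF x])
  have A: "A n \<in> sets half_line" for n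
  proof -
    have "{t \<in> space half_line. t \<le> real n} = {0..real n}" by auto
    then have [measurable]: "{t \<in> space half_line. t \<le> real n} \<in> sets half_line"
      by (simp add: sets_restrict_space_iff)
    have [measurable]: "{t \<in> space half_line. cmod (x t) \<le> real n} \<in> sets half_line" by measurable
    show ?thesis unfolding A_def by (rule sets.sets_Collect) fact+
  qed
  have "(\<lambda>n. N (cut x (- A n))) \<longlonglongrightarrow> 0"
  proof (rule order_continuous[OF est \<open>q > 0\<close> x])
    show "- A n \<in> sets lebesgue" for n using sets_half_line_lebesgue[OF A] by (simp add: Compl_in_sets_lebesgue)
    show "decseq (\<lambda>n. - A n)" unfolding decseq_def A_def by (auto intro: order_trans)
    show "\<exists>k. t \<notin> - A k" if "0 \<le> t" for t
    proof -
      obtain k where "max t (cmod (x t)) \<le> real k" using real_arch_simple by blast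
      then show ?thesis using that by (auto simp: A_def)
    qed
  qed
  then have "\<forall>\<^sub>F n in sequentially. N (cut x (- A n)) < e" using \<open>e > 0\<close> by (rule order_tendstoD)
  then have "\<forall>\<^sub>F n in sequentially. N (cut x (- A n)) < e \<and> n > 0" using eventually_gt_at_top eventually_conj by blast
  then obtain n where n: "N (cut x (- A n)) < e" "n > 0" by (auto simp: eventually_sequentially)
  show thesis
  proof (rule that[of "A n" "real n"])
    have "emeasure half_line (A n) \<le> emeasure half_line {0..real n}"
      by (rule emeasure_mono) (auto simp: A_def sets_restrict_space_iff)
    also have "\<dots> < \<infinity>" by (simp add: emeasure_restrict_space)
    finally show "emeasure half_line (A n) < \<infinity>" .
  qed (use A n in \<open>auto simp: A_def\<close>)
qed

text \<open>By symmetry the norm of an indicator depends only on the measure of the set, so it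
  suffices to look at intervals shrinking to 0.\<close>

lemma small_indicator:
  assumes est: "lower_set_estimate E N q C" and "q > 0" and "e > 0"
  obtains d where "d > 0"
    "\<And>D. D \<in> sets half_line \<Longrightarrow> emeasure half_line D \<le> ennreal d \<Longrightarrow> N (cut (\<lambda>_. 1) D) < e"
proof -
  have U: "{0..1} \<in> sets half_line" "{0<..r} \<in> sets half_line" for r :: real
    by (auto simp: sets_restrict_space_iff)
  have 1: "cut (\<lambda>_. 1) {0..1} \<in> E"
    by (rule indicator_mem[OF U(1)]) (simp add: emeasure_restrict_space)
  \<comment> \<open>The intervals omit 0, because the sets in \<open>order_continuous\<close> must
    have empty intersection at every point.\<close>
  have "(\<lambda>n. N (cut (cut (\<lambda>_. 1) {0..1}) {0<..1 / Suc n})) \<longlonglongrightarrow> 0"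
  proof (rule order_continuous[OF est \<open>q > 0\<close> 1])
    show "decseq (\<lambda>n. {0<..1 / real (Suc n)})"
    proof (rule decseq_SucI)
      fix n have "1 / real (Suc (Suc n)) \<le> 1 / real (Suc n)" by (simp add: divide_simps)
      then show "{0<..1 / real (Suc (Suc n))} \<subseteq> {0<..1 / real (Suc n)}" by auto
    qed
    show "\<exists>k. t \<notin> {0<..1 / real (Suc k)}" if t: "0 \<le> t" for t
    proof (cases "t = 0")
      case False
      then obtain n where "1 / real (Suc n) < t"
        using t reals_Archimedean[of t] by (metis inverse_eq_divide order_le_less)
      then have "t \<notin> {0<..1 / real (Suc n)}" by simp
      then show ?thesis by blast
    qed auto
  qed auto
  then have "\<forall>\<^sub>F n in sequentially. N (cut (cut (\<lambda>_. 1) {0..1}) {0<..1 / Suc n}) < e"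
    using \<open>e > 0\<close> by (rule order_tendstoD)
  then obtain n where n: "N (cut (cut (\<lambda>_. 1) {0..1}) {0<..1 / Suc n}) < e"
    by (auto simp: eventually_sequentially)
  have le_1: "1 / real (Suc n) \<le> 1" by (simp add: divide_simps)
  then have "{0..1} \<inter> {0<..1 / Suc n} = {0<..1 / real (Suc n)}"
    by (auto simp del: of_nat_Suc intro: order_trans[OF _ le_1])
  then have n': "N (cut (\<lambda>_. 1) {0<..1 / real (Suc n)}) < e" using n by simp
  show thesis
  proof (rule that[of "1 / real (Suc n)"])
    fix D assume D: "D \<in> sets half_line" and le: "emeasure half_line D \<le> ennreal (1 / real (Suc n))"
    have fin: "emeasure half_line D < \<infinity>" using le_less_trans[OF le ennreal_less_top] by simp
    define r where "r = measure half_line D"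
    have r: "emeasure half_line D = ennreal r" "0 \<le> r"
      using fin by (auto simp: r_def emeasure_eq_ennreal_measure)
    then have "r \<le> 1 / real (Suc n)" using le by (subst (asm) r(1)) (simp add: ennreal_le_iff)
    have eq: "emeasure half_line {0<..r} = ennreal r"
      using r(2) by (subst emeasure_restrict_space) auto
    have IE: "cut (\<lambda>_. 1) {0<..s} \<in> E" for s
      by (rule indicator_mem[OF U(2)], subst emeasure_restrict_space) (cases "0 \<le> s"; auto)+
    have "N (cut (\<lambda>_. 1) D) = N (cut (\<lambda>_. 1) {0<..r})"
    proof (rule equimeasurable[OF IE])
      show "cut (\<lambda>_. 1) D \<in> borel_measurable half_line"
        using sets_half_line_lebesgue[OF D] by measurable
    qed (simp add: distribution_function_indicator D U r(1) eq)
    also have "\<dots> \<le> N (cut (\<lambda>_. 1) {0<..1 / real (Suc n)})"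
      using \<open>r \<le> 1 / real (Suc n)\<close> measurable[OF IE]
      by (intro norm_mono[OF IE]) (auto simp: cut_def)
    also have "\<dots> < e" by (rule n')
    finally show "N (cut (\<lambda>_. 1) D) < e" .
  qed simp
qed

end

subsection \<open>The uniform Kadec-Klee-Huff property from a lower estimate with constant 1\<close>

context symmetric_banach_function_space
begin

lemma norm_cut_split:
  assumes "x \<in> E" "B \<in> sets lebesgue"
  shows "N x \<le> N (cut x B) + N (cut x (- B))"
proof -
  have B': "- B \<in> sets lebesgue" using assms(2) by (simp add: Compl_in_sets_lebesgue)
  have "(\<lambda>t. cut x B t + cut x (- B) t) = x" by (auto simp: cut_def)
  then show ?thesis
    using norm_triangle[OF cut_mem[OF assms] cut_mem[OF assms(1) B']] by simp
qed

lemma norm_cut_bounded: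
  assumes x: "x \<in> E" and D: "D \<in> sets half_line" "emeasure half_line D < \<infinity>"
    and bound: "0 \<le> M" "\<And>t. t \<in> D \<Longrightarrow> cmod (x t) \<le> M"
  shows "N (cut x D) \<le> M * N (cut (\<lambda>_. 1) D)"
proof -
  have "N (cut x D) \<le> N (\<lambda>t. complex_of_real M * cut (\<lambda>_. 1) D t)"
    using bound measurable[OF cut_mem[OF x sets_half_line_lebesgue[OF D(1)]]]
    by (intro norm_mono(2)[OF scale_closed[OF indicator_mem[OF D]]]) (auto simp: cut_def)
  also have "\<dots> = M * N (cut (\<lambda>_. 1) D)"
    using norm_scale[OF indicator_mem[OF D], of "complex_of_real M"] bound(1) by simp
  finally show ?thesis .
qed

text \<open>\<open>est\<close> enters only through order continuity, with an arbitrary constant;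
  \<open>split\<close> carries the argument. A piece of \<open>X n\<close> of norm at least 1 - d
  leaves at most (1 - (1 - d)^q)^(1/q) for the complementary piece, a bound depending on d and q
  alone, which is where the uniformity comes from.\<close>

lemma uniform_Kadec_Klee_Huff_if_split:
  assumes est: "lower_set_estimate E N q C" and q: "q > 1"
    and split: "\<And>x P. x \<in> E \<Longrightarrow> P \<in> sets lebesgue \<Longrightarrow>
      N (cut x P) powr q + N (cut x (- P)) powr q \<le> N x powr q"
  shows "uniform_Kadec_Klee_Huff E N"
  unfolding uniform_Kadec_Klee_Huff_def
proof (intro allI impI)
  fix e :: real assume "e > 0"
  \<comment> \<open>\<open>r\<close> will be (1 - d)^q. It is close enough to 1 to leave at most
    (e/8)^q for the remainder; the maximum with 1/2 keeps it positive, so that d < 1 even for large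
    \<open>e\<close>.\<close>
  define r where "r = max (1 - (e / 8) powr q) (1 / 2)"
  have r: "1 / 2 \<le> r" "r < 1" "1 - (e / 8) powr q \<le> r"
    using \<open>e > 0\<close> by (auto simp: r_def)
  define d where "d = 1 - r powr (1 / q)"
  have "r powr (1 / q) < 1"
    using r q powr_less_mono2[of "1 / q" r 1] by simp
  moreover have "r powr (1 / q) > 0" using r by simp
  moreover have "(r powr (1 / q)) powr q = r" using r q by (simp add: powr_powr)
  ultimately have d: "0 < d" "d < 1" "1 - (1 - d) powr q \<le> (e / 8) powr q"
    using r by (auto simp: d_def)
  have "\<exists>K. \<forall>n\<ge>K. \<forall>m\<ge>K. N (\<lambda>t. X n t - X m t) \<le> e"
    if X: "\<And>n. X n \<in> E" "\<And>n. N (X n) \<le> 1" and x: "x \<in> E"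
      and conv: "tendsto_locally_in_measure X x" and large: "N x > 1 - d" for X x
  proof -
    \<comment> \<open>Three errors of size at most \<open>g\<close> separate \<open>N x\<close> from
      the norm of \<open>X n\<close> on the good set: the tail of \<open>x\<close>, its part on
      \<open>D n\<close>, and the difference on \<open>B\<close>. The bound e/8 serves the final
      distance g + (e/8 + g) \<le> e/2.\<close>
    define g where "g = min (e / 8) ((N x - (1 - d)) / 4)"
    have g: "g > 0" "g \<le> e / 8" "4 * g \<le> N x - (1 - d)"
      using \<open>e > 0\<close> large by (auto simp: g_def min_def)
    obtain A M where A: "A \<in> sets half_line" "emeasure half_line A < \<infinity>" and "M > 0"
      and M: "\<And>t. t \<in> A \<Longrightarrow> cmod (x t) \<le> M" and tail: "N (cut x (- A)) < g"
      using truncation[OF est _ x g(1)] q by (metis less_trans zero_less_one)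
    obtain d' where "d' > 0" and small: "\<And>D. D \<in> sets half_line \<Longrightarrow>
        emeasure half_line D \<le> ennreal d' \<Longrightarrow> N (cut (\<lambda>_. 1) D) < g / M"
      using small_indicator[OF est, of "g / M"] q g(1) \<open>M > 0\<close>
      by (metis divide_pos_pos less_trans zero_less_one)
    \<comment> \<open>A pointwise error \<open>c\<close> on \<open>A\<close> costs at most
      \<open>g\<close> in norm; the \<open>+ 1\<close> avoids division by 0 when \<open>A\<close> is
      a null set.\<close>
    define c where "c = g / (N (cut (\<lambda>_. 1) A) + 1)"
    have nA: "N (cut (\<lambda>_. 1) A) \<ge> 0" by (rule norm_nonneg[OF indicator_mem[OF A]])
    then have c: "c > 0" "c * N (cut (\<lambda>_. 1) A) \<le> g"
      using g(1) by (auto simp: c_def field_simps)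
    define D where "D n = {t \<in> A. cmod (X n t - x t) > c}" for n
    have "(\<lambda>n. emeasure half_line (D n)) \<longlonglongrightarrow> 0"
      using conv A c(1) unfolding tendsto_locally_in_measure_def D_def by blast
    then have "\<forall>\<^sub>F n in sequentially. emeasure half_line (D n) < ennreal d'"
      using \<open>d' > 0\<close> by (intro order_tendstoD(2)) auto
    then obtain K where K: "\<And>n. n \<ge> K \<Longrightarrow> emeasure half_line (D n) < ennreal d'"
      by (auto simp: eventually_sequentially)
    have AL: "A \<in> sets lebesgue" by (rule sets_half_line_lebesgue[OF A(1)])
    have xA: "cut x A \<in> E" by (rule cut_mem[OF x AL])
    have close: "N (\<lambda>t. X n t - cut x A t) \<le> e / 2" if "n \<ge> K" for n
    proof -
      have Xx: "(\<lambda>t. X n t - x t) \<in> E" by (rule minus_closed[OF X(1) x])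
      have "D n = A \<inter> {t \<in> space half_line. cmod (X n t - x t) > c}"
        using sets.sets_into_space[OF A(1)] by (auto simp: D_def)
      moreover have "{t \<in> space half_line. cmod (X n t - x t) > c} \<in> sets half_line"
        using superlevel_set_measurable[OF measurable[OF Xx], of c] by simp
      ultimately have D: "D n \<in> sets half_line" using A(1) by auto
      have DL: "D n \<in> sets lebesgue" by (rule sets_half_line_lebesgue[OF D])
      \<comment> \<open>On \<open>B\<close> the function \<open>X n\<close> is within
        \<open>c\<close> of \<open>x\<close>. On the omitted set \<open>D n\<close> the function
        \<open>x\<close> is bounded by \<open>M\<close> and the measure is small, so little of the
        norm of \<open>x\<close> is lost.\<close>
      define B where "B = A - D n"
      have B: "B \<in> sets half_line" "emeasure half_line B < \<infinity>"
        using A D emeasure_mono[of B A half_line] by (auto simp: B_def)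
      have BL: "B \<in> sets lebesgue" "- B \<in> sets lebesgue"
        using sets_half_line_lebesgue[OF B(1)] by (auto simp: Compl_in_sets_lebesgue)
      have Dfin: "emeasure half_line (D n) < \<infinity>"
        using A D emeasure_mono[of "D n" A half_line] by (auto simp: D_def)
      have DA: "D n \<subseteq> A" by (auto simp: D_def)
      have "N (cut x (D n)) \<le> M * N (cut (\<lambda>_. 1) (D n))"
        using M \<open>M > 0\<close> DA by (intro norm_cut_bounded x D Dfin) auto
      also have "\<dots> \<le> M * (g / M)"
        using small[OF D less_imp_le[OF K[OF that]]] \<open>M > 0\<close> by (intro mult_left_mono) auto
      finally have f1: "N (cut x (D n)) \<le> g" using \<open>M > 0\<close> by simp
      have "N (cut (\<lambda>t. X n t - x t) B) \<le> c * N (cut (\<lambda>_. 1) B)"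
        using c(1) by (intro norm_cut_bounded Xx B) (auto simp: B_def D_def)
      also have "\<dots> \<le> c * N (cut (\<lambda>_. 1) A)"
        using c(1) measurable[OF indicator_mem[OF B]]
        by (intro mult_left_mono norm_mono(2)[OF indicator_mem[OF A]]) (auto simp: cut_def B_def)
      finally have f2: "N (cut (\<lambda>t. X n t - x t) B) \<le> g" using c(2) by simp
      have "N x \<le> N (cut x A) + N (cut x (- A))" by (rule norm_cut_split[OF x AL])
      moreover have "N (cut x A) \<le> N (cut x (D n)) + N (cut x B)"
        using norm_cut_split[OF xA DL] DA by (simp add: B_def Diff_eq Int_absorb1)
      moreover have "N (cut x B) \<le> N (cut (X n) B) + N (cut (\<lambda>t. X n t - x t) B)"
      proof -
        have "(\<lambda>t. cut (X n) B t - cut x B t) = cut (\<lambda>t. X n t - x t) B"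
          by (auto simp: cut_def)
        then show ?thesis
          using norm_le_diff[OF cut_mem[OF x BL(1)] cut_mem[OF X(1) BL(1)], of n]
            norm_minus_commute[OF cut_mem[OF x BL(1)] cut_mem[OF X(1) BL(1)], of n] by simp
      qed
      ultimately have "N (cut (X n) B) \<ge> 1 - d" using f1 f2 tail g(1,3) by linarith
      then have "(1 - d) powr q \<le> N (cut (X n) B) powr q"
        using d q by (intro powr_mono2) auto
      moreover have "N (X n) powr q \<le> 1"
        using powr_mono2[of q "N (X n)" 1] X(2) norm_nonneg[OF X(1)] q by simp
      ultimately have "N (cut (X n) (- B)) powr q \<le> (e / 8) powr q"
        using split[OF X(1) BL(1), of n] d(3) by linarith
      then have f5: "N (cut (X n) (- B)) \<le> e / 8"
        using powr_less_mono2[of q "e / 8" "N (cut (X n) (- B))"] q \<open>e > 0\<close> by fastforce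
      let ?y = "\<lambda>t. X n t - cut x A t"
      have y: "?y \<in> E" by (rule minus_closed[OF X(1) xA])
      have "N ?y \<le> N (cut ?y B) + N (cut ?y (- B))" by (rule norm_cut_split[OF y BL(1)])
      moreover have "cut ?y B = cut (\<lambda>t. X n t - x t) B" by (auto simp: cut_def B_def)
      moreover have "cut ?y (- B) = (\<lambda>t. cut (X n) (- B) t - cut x (D n) t)"
        using DA by (auto simp: cut_def B_def fun_eq_iff)
      moreover have "N (\<lambda>t. cut (X n) (- B) t - cut x (D n) t) \<le> N (cut (X n) (- B)) + N (cut x (D n))"
        using norm_triangle[OF cut_mem[OF X(1) BL(2)] scale_closed[OF cut_mem[OF x DL], of "-1"], of n]
          norm_scale[OF cut_mem[OF x DL], of "-1"] by simp
      ultimately have "N ?y \<le> g + (e / 8 + g)" using f1 f2 f5 by simp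
      then show ?thesis using g(2) \<open>e > 0\<close> by linarith
    qed
    have "N (\<lambda>t. X n t - X m t) \<le> e" if "n \<ge> K" "m \<ge> K" for n m
      using norm_triangle_minus[OF X(1) xA X(1), of n m] close[OF that(1)] close[OF that(2)]
        norm_minus_commute[OF X(1) xA, of m] by linarith
    then show ?thesis by blast
  qed
  then show "\<exists>d>0. d < 1 \<and> (\<forall>X x. (\<forall>n. X n \<in> E \<and> N (X n) \<le> 1) \<and> x \<in> E \<and>
           tendsto_locally_in_measure X x \<and> N x > 1 - d \<longrightarrow>
           (\<exists>K. \<forall>n\<ge>K. \<forall>m\<ge>K. N (\<lambda>t. X n t - X m t) \<le> e))"
    using d by (intro exI[of _ d]) blast
qed

end

subsection \<open>The norm given by suprema over disjoint families\<close>

text \<open>Convexity of the power up to the boundary: if one of the two points is 0, the claim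
  reduces to w^q \<le> w for a weight w in [0, 1].\<close>

lemma powr_convex_nonneg:
  fixes x y u v q :: real
  assumes "1 \<le> q" "0 \<le> u" "0 \<le> v" "u + v = 1" "0 \<le> x" "0 \<le> y"
  shows "(u * x + v * y) powr q \<le> u * x powr q + v * y powr q"
proof -
  have *: "(w * z) powr q \<le> w * z powr q" if "0 \<le> w" "w \<le> 1" "0 \<le> z" for w z :: real
  proof -
    have "w powr q \<le> w powr 1" using that assms(1) by (intro powr_mono') auto
    then show ?thesis using that by (auto simp: powr_mult intro!: mult_right_mono)
  qed
  consider "x = 0" | "y = 0" | "x > 0" "y > 0" using assms by linarith
  then show ?thesis
  proof cases
    case 1
    then show ?thesis using *[of v y] assms by simp
  next
    case 2
    then show ?thesis using *[of u x] assms by simp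
  next
    case 3
    have u: "u = 1 - v" using assms(4) by simp
    show ?thesis
      using convex_onD[OF powr_convex[OF assms(1)], of v x y] 3 assms(2,3) unfolding u by simp
  qed
qed

text \<open>Convexity is applied to the normalised entries a i / A and b i / B with weights A/(A+B)
  and B/(A+B). \<open>A\<close> and \<open>B\<close> are mere upper bounds rather than the exact l^q
  norms, so that the suprema in \<open>renorm\<close> can be inserted directly.\<close>

lemma Minkowski_powr:
  fixes a b :: "'i \<Rightarrow> real"
  assumes q: "1 \<le> q" and nonneg: "\<And>i. i \<in> I \<Longrightarrow> 0 \<le> a i" "\<And>i. i \<in> I \<Longrightarrow> 0 \<le> b i" "0 \<le> A" "0 \<le> B"
    and a: "(\<Sum>i\<in>I. a i powr q) \<le> A powr q" and b: "(\<Sum>i\<in>I. b i powr q) \<le> B powr q"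
  shows "(\<Sum>i\<in>I. (a i + b i) powr q) \<le> (A + B) powr q"
proof (cases "finite I")
  case fin: True
  have zero: "c i = 0" if "(\<Sum>i\<in>I. c i powr q) \<le> 0 powr q" "i \<in> I" for c :: "'i \<Rightarrow> real" and i
  proof -
    have "(\<Sum>i\<in>I. c i powr q) = 0" using that(1) q by (intro antisym sum_nonneg) auto
    then show ?thesis using that(2) fin by (subst (asm) sum_nonneg_eq_0_iff) auto
  qed
  consider "A = 0" | "B = 0" | "A > 0" "B > 0" using nonneg by linarith
  then show ?thesis
  proof cases
    case 1
    then show ?thesis using zero[of a] a b by simp
  next
    case 2
    then show ?thesis using zero[of b] a b by simp
  next
    case 3
    let ?u = "A / (A + B)" and ?v = "B / (A + B)"
    have uv: "?u + ?v = 1" using 3 by (simp add: add_divide_distrib[symmetric])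
    have "(\<Sum>i\<in>I. (a i + b i) powr q) \<le>
      (\<Sum>i\<in>I. (A + B) powr q * (?u * (a i powr q / A powr q) + ?v * (b i powr q / B powr q)))"
    proof (rule sum_mono)
      fix i assume i: "i \<in> I"
      have "a i + b i = (A + B) * (?u * (a i / A) + ?v * (b i / B))"
      proof -
        have "?u * (a i / A) = a i / (A + B)" "?v * (b i / B) = b i / (A + B)" using 3 by simp_all
        then show ?thesis using 3 by (simp add: add_divide_distrib[symmetric])
      qed
      then have "(a i + b i) powr q = (A + B) powr q * (?u * (a i / A) + ?v * (b i / B)) powr q"
        using 3 nonneg i by (metis powr_mult)
      also have "\<dots> \<le> (A + B) powr q * (?u * (a i / A) powr q + ?v * (b i / B) powr q)"
        using 3 nonneg i q uv by (intro mult_left_mono powr_convex_nonneg) auto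
      finally show "(a i + b i) powr q \<le>
          (A + B) powr q * (?u * (a i powr q / A powr q) + ?v * (b i powr q / B powr q))"
        using 3 nonneg i by (simp add: powr_divide)
    qed
    also have "\<dots> = (A + B) powr q *
        (?u * ((\<Sum>i\<in>I. a i powr q) / A powr q) + ?v * ((\<Sum>i\<in>I. b i powr q) / B powr q))"
      by (simp only: sum_divide_distrib sum_distrib_left sum.distrib[symmetric])
    also have "\<dots> \<le> (A + B) powr q * (?u * 1 + ?v * 1)"
      using 3 a b by (intro mult_left_mono add_mono) auto
    finally show ?thesis using uv by simp
  qed
qed auto

definition block_sums ::
  "((real \<Rightarrow> complex) \<Rightarrow> real) \<Rightarrow> real \<Rightarrow> (real \<Rightarrow> complex) \<Rightarrow> real set" where
  "block_sums N q x = {\<Sum>i<n. N (cut x (A i)) powr q | (n::nat) A.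
     (\<forall>i<n. A i \<in> sets lebesgue) \<and> disjoint_family_on A {..<n}}"

definition renorm :: "((real \<Rightarrow> complex) \<Rightarrow> real) \<Rightarrow> real \<Rightarrow> (real \<Rightarrow> complex) \<Rightarrow> real" where
  "renorm N q x = Sup (block_sums N q x) powr (1 / q)"

locale lower_estimate_space = symmetric_banach_function_space +
  fixes q C :: real
  assumes q: "q > 1" and C: "C > 0" and est: "lower_set_estimate E N q C"
begin

text \<open>The lower estimate bounds the block sums from above, and the empty family contributes 0;
  hence the supremum is genuine and non-negative, and the root can be undone.\<close>

lemma renorm_powr:
  assumes x: "x \<in> E"
  shows "renorm N q x powr q = Sup (block_sums N q x)" "bdd_above (block_sums N q x)"
    "block_sums N q x \<noteq> {}"
proof -
  have "s \<le> C * N x powr q" if s: "s \<in> block_sums N q x" for s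
  proof -
    obtain n A where "s = (\<Sum>i<(n::nat). N (cut x (A i)) powr q)"
      "\<forall>i<n. A i \<in> sets lebesgue" "disjoint_family_on A {..<n}"
      using s unfolding block_sums_def by blast
    then show ?thesis using lower_set_estimateD[OF est x] by simp
  qed
  then show bdd: "bdd_above (block_sums N q x)" by (auto simp: bdd_above_def)
  have 0: "0 \<in> block_sums N q x"
    unfolding block_sums_def by (rule CollectI, rule exI[of _ 0]) (simp add: disjoint_family_on_def)
  then show "block_sums N q x \<noteq> {}" by blast
  have "0 \<le> Sup (block_sums N q x)" using 0 bdd by (rule cSup_upper)
  then show "renorm N q x powr q = Sup (block_sums N q x)"
    using q by (simp add: renorm_def powr_powr)
qed

lemma renorm_nonneg: "0 \<le> renorm N q x"
  by (simp add: renorm_def)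

lemma renorm_upper:
  fixes n :: nat
  assumes "x \<in> E" "\<And>i. i < n \<Longrightarrow> A i \<in> sets lebesgue" "disjoint_family_on A {..<n}"
  shows "(\<Sum>i<n. N (cut x (A i)) powr q) \<le> renorm N q x powr q"
  unfolding renorm_powr(1)[OF assms(1)]
  using assms(2,3) renorm_powr(2)[OF assms(1)] by (intro cSup_upper) (auto simp: block_sums_def)

text \<open>Here \<open>c\<close> is any real number and not of the form of a q-th power, which
  admits the differences of powers occurring in \<open>renorm_split\<close>.\<close>

lemma renorm_powr_le:
  assumes "x \<in> E"
    and "\<And>(n::nat) A. (\<And>i. i < n \<Longrightarrow> A i \<in> sets lebesgue) \<Longrightarrow> disjoint_family_on A {..<n} \<Longrightarrow>
      (\<Sum>i<n. N (cut x (A i)) powr q) \<le> c"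
  shows "renorm N q x powr q \<le> c"
  unfolding renorm_powr(1)[OF assms(1)]
  using assms(2) renorm_powr(3)[OF assms(1)] by (intro cSup_least) (auto simp: block_sums_def)

lemma le_of_powr_le:
  assumes "a powr q \<le> c powr q" "0 \<le> c"
  shows "a \<le> c"
  using assms q powr_less_mono2[of q c a] by fastforce

lemma renorm_le:
  assumes "x \<in> E" "0 \<le> c"
    and "\<And>(n::nat) A. (\<And>i. i < n \<Longrightarrow> A i \<in> sets lebesgue) \<Longrightarrow> disjoint_family_on A {..<n} \<Longrightarrow>
      (\<Sum>i<n. N (cut x (A i)) powr q) \<le> c powr q"
  shows "renorm N q x \<le> c"
  by (rule le_of_powr_le[OF renorm_powr_le[OF assms(1,3)] assms(2)])

lemma norm_le_renorm:
  assumes "x \<in> E"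
  shows "N x \<le> renorm N q x"
  using renorm_upper[OF assms, of 1 "\<lambda>_. UNIV"] le_of_powr_le renorm_nonneg
  by (simp add: disjoint_family_on_def)

lemma renorm_le_norm:
  assumes x: "x \<in> E"
  shows "renorm N q x \<le> C powr (1 / q) * N x"
proof (rule renorm_le[OF x])
  show "0 \<le> C powr (1 / q) * N x" using norm_nonneg[OF x] by simp
  show "(\<Sum>i<n. N (cut x (A i)) powr q) \<le> (C powr (1 / q) * N x) powr q"
    if "\<And>i. i < n \<Longrightarrow> A i \<in> sets lebesgue" "disjoint_family_on A {..<n}" for n :: nat and A
    using lower_set_estimateD[OF est x that] q C norm_nonneg[OF x] by (simp add: powr_mult powr_powr)
qed

lemma equivalent_norms_renorm: "equivalent_norms E N (renorm N q)"
  unfolding equivalent_norms_def using norm_le_renorm renorm_le_norm C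
  by (intro exI[of _ 1] exI[of _ "C powr (1 / q)"] conjI ballI) auto

lemma renorm_mono:
  assumes y: "y \<in> E" and x: "x \<in> E"
    and le: "AE t in half_line. cmod (x t) \<le> cmod (y t)"
  shows "renorm N q x \<le> renorm N q y"
proof (rule renorm_le[OF x renorm_nonneg])
  fix n :: nat and A :: "nat \<Rightarrow> real set"
  assume A: "\<And>i. i < n \<Longrightarrow> A i \<in> sets lebesgue" "disjoint_family_on A {..<n}"
  have "N (cut x (A i)) \<le> N (cut y (A i))" if "i < n" for i
  proof -
    have "AE t in half_line. cmod (cut x (A i) t) \<le> cmod (cut y (A i) t)"
      using le by eventually_elim (auto simp: cut_def)
    then show ?thesis
      using ideal[OF cut_mem[OF y A(1)[OF that]] measurable[OF cut_mem[OF x A(1)[OF that]]]] by simp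
  qed
  then have "(\<Sum>i<n. N (cut x (A i)) powr q) \<le> (\<Sum>i<n. N (cut y (A i)) powr q)"
    using q A x norm_nonneg cut_mem by (intro sum_mono powr_mono2) auto
  also have "\<dots> \<le> renorm N q y powr q" by (rule renorm_upper[OF y A])
  finally show "(\<Sum>i<n. N (cut x (A i)) powr q) \<le> renorm N q y powr q" .
qed

lemma renorm_triangle:
  assumes x: "x \<in> E" and y: "y \<in> E"
  shows "renorm N q (\<lambda>t. x t + y t) \<le> renorm N q x + renorm N q y"
proof (rule renorm_le[OF add_closed[OF x y]])
  show "0 \<le> renorm N q x + renorm N q y" using renorm_nonneg by simp
  fix n :: nat and A :: "nat \<Rightarrow> real set"
  assume A: "\<And>i. i < n \<Longrightarrow> A i \<in> sets lebesgue" "disjoint_family_on A {..<n}"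
  have "N (cut (\<lambda>t. x t + y t) (A i)) \<le> N (cut x (A i)) + N (cut y (A i))" if "i < n" for i
  proof -
    have "cut (\<lambda>t. x t + y t) (A i) = (\<lambda>t. cut x (A i) t + cut y (A i) t)" by (auto simp: cut_def)
    then show ?thesis using norm_triangle[OF cut_mem[OF x A(1)[OF that]] cut_mem[OF y A(1)[OF that]]]
      by simp
  qed
  then have "(\<Sum>i<n. N (cut (\<lambda>t. x t + y t) (A i)) powr q) \<le>
      (\<Sum>i<n. (N (cut x (A i)) + N (cut y (A i))) powr q)"
    using q A add_closed[OF x y] norm_nonneg cut_mem by (intro sum_mono powr_mono2) auto
  also have "\<dots> \<le> (renorm N q x + renorm N q y) powr q"
    using q A x y norm_nonneg cut_mem renorm_nonneg
    by (intro Minkowski_powr renorm_upper) auto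
  finally show "(\<Sum>i<n. N (cut (\<lambda>t. x t + y t) (A i)) powr q) \<le>
    (renorm N q x + renorm N q y) powr q" .
qed

lemma renorm_scale:
  assumes x: "x \<in> E"
  shows "renorm N q (\<lambda>t. c * x t) = cmod c * renorm N q x"
proof -
  have le: "renorm N q (\<lambda>t. c * y t) \<le> cmod c * renorm N q y" if y: "y \<in> E" for c y
  proof (rule renorm_le[OF scale_closed[OF y]])
    show "0 \<le> cmod c * renorm N q y" using renorm_nonneg by simp
    fix n :: nat and A :: "nat \<Rightarrow> real set"
    assume A: "\<And>i. i < n \<Longrightarrow> A i \<in> sets lebesgue" "disjoint_family_on A {..<n}"
    have "N (cut (\<lambda>t. c * y t) (A i)) = cmod c * N (cut y (A i))" if "i < n" for i
    proof -
      have "cut (\<lambda>t. c * y t) (A i) = (\<lambda>t. c * cut y (A i) t)" by (auto simp: cut_def)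
      then show ?thesis using norm_scale[OF cut_mem[OF y A(1)[OF that]]] by simp
    qed
    then have "(\<Sum>i<n. N (cut (\<lambda>t. c * y t) (A i)) powr q) =
        cmod c powr q * (\<Sum>i<n. N (cut y (A i)) powr q)"
      using A y norm_nonneg cut_mem by (simp add: powr_mult sum_distrib_left)
    also have "\<dots> \<le> cmod c powr q * renorm N q y powr q"
      by (intro mult_left_mono renorm_upper[OF y A]) auto
    also have "\<dots> = (cmod c * renorm N q y) powr q"
      using renorm_nonneg by (simp add: powr_mult)
    finally show "(\<Sum>i<n. N (cut (\<lambda>t. c * y t) (A i)) powr q) \<le> (cmod c * renorm N q y) powr q" .
  qed
  show ?thesis
  proof (cases "c = 0")
    case True
    then show ?thesis using le[OF x, of 0] renorm_nonneg[of "\<lambda>t. 0 * x t"] by simp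
  next
    case False
    have "renorm N q (\<lambda>t. inverse c * (c * x t)) \<le> cmod (inverse c) * renorm N q (\<lambda>t. c * x t)"
      by (rule le[OF scale_closed[OF x]])
    then have "renorm N q x \<le> inverse (cmod c) * renorm N q (\<lambda>t. c * x t)"
      using False by (simp add: mult.assoc[symmetric] norm_inverse)
    then have "cmod c * renorm N q x \<le> renorm N q (\<lambda>t. c * x t)"
      using False by (simp add: field_simps)
    with le[OF x, of c] show ?thesis by simp
  qed
qed

text \<open>A disjoint family inside P and one inside the complement of P join to a single disjoint
  family for \<open>x\<close>, so block sums simply add and no constant is lost. The two suprema are
  then taken one after the other.\<close>

lemma renorm_split:
  assumes x: "x \<in> E" and P: "P \<in> sets lebesgue"
  shows "renorm N q (cut x P) powr q + renorm N q (cut x (- P)) powr q \<le> renorm N q x powr q"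
proof -
  have P': "- P \<in> sets lebesgue" using P by (simp add: Compl_in_sets_lebesgue)
  have main: "(\<Sum>i<n. N (cut (cut x P) (A i)) powr q) + (\<Sum>i<m. N (cut (cut x (- P)) (B i)) powr q)
      \<le> renorm N q x powr q"
    if A: "\<And>i. i < n \<Longrightarrow> A i \<in> sets lebesgue" "disjoint_family_on A {..<n}"
      and B: "\<And>i. i < m \<Longrightarrow> B i \<in> sets lebesgue" "disjoint_family_on B {..<m}" for n m :: nat and A B
  proof -
    \<comment> \<open>Indices below n carry the first family, the next m indices the second one
      shifted by n.\<close>
    define D where "D i = (if i < n then P \<inter> A i else - P \<inter> B (i - n))" for i
    have "(\<Sum>i<n+k. f i) = (\<Sum>i<n. f i) + (\<Sum>i<k. f (n + i))" for f :: "nat \<Rightarrow> real" and k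
      by (induction k) auto
    then have "(\<Sum>i<n+m. N (cut x (D i)) powr q) =
      (\<Sum>i<n. N (cut x (D i)) powr q) + (\<Sum>i<m. N (cut x (D (n + i))) powr q)" .
    moreover have "(\<Sum>i<n+m. N (cut x (D i)) powr q) \<le> renorm N q x powr q"
    proof (rule renorm_upper[OF x])
      show "D i \<in> sets lebesgue" if "i < n + m" for i
        using that A(1)[of i] B(1)[of "i - n"] P P' by (auto simp: D_def)
      show "disjoint_family_on D {..<n + m}"
        unfolding disjoint_family_on_def
      proof (intro ballI impI)
        fix i j assume ij: "i \<in> {..<n + m}" "j \<in> {..<n + m}" "i \<noteq> j"
        have "A i \<inter> A j = {}" if "i < n" "j < n"
          using A(2) ij that by (auto simp: disjoint_family_on_def)
        moreover have "B (i - n) \<inter> B (j - n) = {}" if "\<not> i < n" "\<not> j < n"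
        proof -
          have "i - n < m" "j - n < m" "i - n \<noteq> j - n" using ij that by auto
          then show ?thesis using B(2) unfolding disjoint_family_on_def by blast
        qed
        ultimately show "D i \<inter> D j = {}" by (auto simp: D_def)
      qed
    qed
    ultimately show ?thesis by (simp add: D_def)
  qed
  have "renorm N q (cut x P) powr q \<le> renorm N q x powr q - renorm N q (cut x (- P)) powr q"
  proof (rule renorm_powr_le[OF cut_mem[OF x P]])
    fix n :: nat and A :: "nat \<Rightarrow> real set"
    assume A: "\<And>i. i < n \<Longrightarrow> A i \<in> sets lebesgue" "disjoint_family_on A {..<n}"
    let ?a = "\<Sum>i<n. N (cut (cut x P) (A i)) powr q"
    have "renorm N q (cut x (- P)) powr q \<le> renorm N q x powr q - ?a"
    proof (rule renorm_powr_le[OF cut_mem[OF x P']])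
      fix m :: nat and B :: "nat \<Rightarrow> real set"
      assume "\<And>i. i < m \<Longrightarrow> B i \<in> sets lebesgue" "disjoint_family_on B {..<m}"
      from main[OF A this]
      show "(\<Sum>i<m. N (cut (cut x (- P)) (B i)) powr q) \<le> renorm N q x powr q - ?a" by linarith
    qed
    then show "?a \<le> renorm N q x powr q - renorm N q (cut x (- P)) powr q" by linarith
  qed
  then show ?thesis by linarith
qed

end

subsection \<open>Symmetry of the new norm\<close>

text \<open>The measure of Y \<inter> [0, t] is a 1-Lipschitz function of t, so the intermediate
  value theorem applies. The full measure of Y is treated apart, since it may be approached without
  being attained at a finite t.\<close>

lemma half_line_subset_of_measure:
  assumes Y: "Y \<in> sets half_line" "emeasure half_line Y < \<infinity>" and a: "0 \<le> a" "a \<le> measure half_line Y"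
  obtains Z where "Z \<in> sets half_line" "Z \<subseteq> Y" "measure half_line Z = a"
proof (cases "a = measure half_line Y")
  case True
  then show thesis using that Y(1) by blast
next
  case False
  define g where "g t = measure half_line (Y \<inter> {0..t})" for t
  have I: "{s<..t} \<in> sets half_line" if "0 \<le> s" for s t
    using that by (auto simp: sets_restrict_space_iff)
  have J: "{0..t} \<in> sets half_line" for t
    by (auto simp: sets_restrict_space_iff)
  have Yf: "Y \<in> fmeasurable half_line" using Y by (simp add: fmeasurable_def)
  have YJ: "Y \<inter> {0..t} \<in> fmeasurable half_line" for t
    using Yf J by (rule fmeasurable_Int_fmeasurable)
  have mI: "measure half_line {s<..t} = t - s" "{s<..t} \<in> fmeasurable half_line" if "0 \<le> s" "s \<le> t" for s t
  proof -
    have "emeasure half_line {s<..t} = ennreal (t - s)"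
      using that by (subst emeasure_restrict_space) auto
    then show "measure half_line {s<..t} = t - s" "{s<..t} \<in> fmeasurable half_line"
      using that I by (auto simp: measure_def fmeasurable_def)
  qed
  have lip: "g t - g s \<le> t - s" "g s \<le> g t" if "0 \<le> s" "s \<le> t" for s t
  proof -
    have "g t \<le> measure half_line ((Y \<inter> {0..s}) \<union> {s<..t})"
      unfolding g_def using YJ mI[OF that] by (intro measure_mono_fmeasurable fmeasurable.Un) auto
    also have "\<dots> \<le> g s + measure half_line {s<..t}"
      unfolding g_def using YJ mI[OF that] by (intro measure_Un_le) auto
    finally show "g t - g s \<le> t - s" using mI[OF that] by simp
    show "g s \<le> g t"
      unfolding g_def using that YJ by (intro measure_mono_fmeasurable) auto
  qed
  have cont: "continuous_on {0..m} g" for m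
  proof -
    have "1-lipschitz_on {0..m} g"
    proof (rule lipschitz_onI)
      fix s t assume "s \<in> {0..m}" "t \<in> {0..m}"
      then show "dist (g s) (g t) \<le> 1 * dist s t"
        using lip[of s t] lip[of t s] by (cases "s \<le> t") (auto simp: dist_real_def)
    qed simp
    then show ?thesis by (rule lipschitz_on_continuous_on)
  qed
  have "(\<lambda>n. measure half_line (Y \<inter> {0..real n})) \<longlonglongrightarrow> measure half_line (\<Union>n. Y \<inter> {0..real n})"
  proof (rule Lim_measure_incseq)
    have U: "(\<Union>n. Y \<inter> {0..real n}) \<subseteq> Y" by auto
    show "emeasure half_line (\<Union>n. Y \<inter> {0..real n}) \<noteq> \<infinity>"
      using emeasure_mono[OF U Y(1)] Y(2) by (auto simp: top_unique)
  qed (use YJ in \<open>auto simp: incseq_def\<close>)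
  also have "(\<Union>n. Y \<inter> {0..real n}) = Y"
    using sets.sets_into_space[OF Y(1)] real_arch_simple by fastforce
  finally have "\<forall>\<^sub>F n in sequentially. a < measure half_line (Y \<inter> {0..real n})"
    using False a(2) by (intro order_tendstoD(1)) auto
  then obtain n where n: "a < g (real n)"
    by (auto simp: eventually_sequentially g_def)
  have "g 0 \<le> measure half_line {0..0}"
    unfolding g_def by (intro measure_mono_fmeasurable) (use YJ[of 0] J[of 0] in \<open>auto simp: fmeasurable_def emeasure_restrict_space\<close>)
  then have "g 0 \<le> a" using a(1) by (simp add: measure_restrict_space)
  then obtain t where "g t = a"
    using IVT'[of g 0 a "real n"] n cont by auto
  then show thesis using that[of "Y \<inter> {0..t}"] YJ by (auto simp: g_def)
qed

lemma half_line_disjoint_subsets_of_measure: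
  fixes a :: "nat \<Rightarrow> real"
  assumes "Y \<in> sets half_line" "emeasure half_line Y < \<infinity>" "\<And>i. i < n \<Longrightarrow> 0 \<le> a i"
    "(\<Sum>i<n. a i) \<le> measure half_line Y"
  shows "\<exists>B. (\<forall>i<n. B i \<in> sets half_line \<and> B i \<subseteq> Y \<and> measure half_line (B i) = a i) \<and>
    disjoint_family_on B {..<n}"
  using assms
proof (induction n arbitrary: Y)
  case 0
  then show ?case by (auto simp: disjoint_family_on_def)
next
  case (Suc n)
  have "(\<Sum>i<n. a i) \<ge> 0" using Suc.prems(3) by (intro sum_nonneg) auto
  then obtain Z where Z: "Z \<in> sets half_line" "Z \<subseteq> Y" "measure half_line Z = a n"
    using half_line_subset_of_measure[OF Suc.prems(1,2), of "a n"] Suc.prems(3)[of n] Suc.prems(4) by auto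
  have "measure half_line (Y - Z) = measure half_line Y - a n"
    using Z Suc.prems(1,2) by (subst measure_Diff) auto
  moreover have "emeasure half_line (Y - Z) < \<infinity>"
    using emeasure_mono[of "Y - Z" Y half_line] Suc.prems(1,2) by auto
  ultimately obtain B where B: "\<forall>i<n. B i \<in> sets half_line \<and> B i \<subseteq> Y - Z \<and> measure half_line (B i) = a i"
    "disjoint_family_on B {..<n}"
    using Suc.IH[of "Y - Z"] Z(1) Suc.prems by auto
  define B' where "B' = B(n := Z)"
  have "\<forall>i<Suc n. B' i \<in> sets half_line \<and> B' i \<subseteq> Y \<and> measure half_line (B' i) = a i"
    using B(1) Z by (auto simp: B'_def less_Suc_eq)
  moreover have "disjoint_family_on B' {..<Suc n}"
    unfolding disjoint_family_on_def
  proof (intro ballI impI)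
    fix i k assume ik: "i \<in> {..<Suc n}" "k \<in> {..<Suc n}" "i \<noteq> k"
    have B'n: "B' n = Z" and B'i: "B' l = B l" if "l < n" for l using that by (auto simp: B'_def)
    have Z_disj: "Z \<inter> B l = {}" if "l < n" for l using B(1) that by blast
    consider "i = n" "k < n" | "k = n" "i < n" | "i < n" "k < n" using ik by fastforce
    then show "B' i \<inter> B' k = {}"
    proof cases
      case 3
      then have "B i \<inter> B k = {}" using B(2) ik(3) by (auto simp: disjoint_family_on_def)
      then show ?thesis using 3 B'i by simp
    qed (use B'n B'i Z_disj in \<open>auto simp: Int_commute\<close>)
  qed
  ultimately show ?case by blast
qed

text \<open>The ceiling minus 1 gives the levels h j < s \<le> h (j + 1), open on the left, so that
  level sets are differences of the sets {|x| > s} measured by the distribution function. Truncation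
  by \<open>nat\<close> puts s = 0 into level 0, the only level whose set can have infinite measure
  for elements of the spaces considered.\<close>

definition level :: "real \<Rightarrow> real \<Rightarrow> nat" where
  "level h s = nat (\<lceil>s / h\<rceil> - 1)"

lemma level_bounds:
  assumes "h > 0" "s \<ge> 0"
  shows "h * real (level h s) \<le> s" "s - h * real (level h s) \<le> h"
proof -
  have "real (level h s) \<le> s / h" "s / h - 1 \<le> real (level h s)"
    using assms ceiling_correct[of "s / h"] divide_nonneg_pos[of s h] unfolding level_def by linarith+
  then show "h * real (level h s) \<le> s" "s - h * real (level h s) \<le> h"
    using assms by (simp_all add: field_simps)
qed

lemma level_eq_iff:
  assumes "h > 0" "j > 0"
  shows "level h s = j \<longleftrightarrow> h * real j < s \<and> s \<le> h * (real j + 1)"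
proof -
  have "level h s = j \<longleftrightarrow> real j < s / h \<and> s / h \<le> real j + 1"
    using assms(2) unfolding level_def by linarith
  then show ?thesis using assms(1) by (simp add: field_simps)
qed

lemma level_measurable [measurable]: "level h \<in> borel \<rightarrow>\<^sub>M count_space UNIV"
  unfolding level_def by measurable

text \<open>Approximates |x| from below, not \<open>x\<close> itself; this suffices because a
  lattice norm depends on the modulus only.\<close>

definition step :: "(real \<Rightarrow> complex) \<Rightarrow> real \<Rightarrow> real \<Rightarrow> complex" where
  "step x h t = of_real (h * real (level h (cmod (x t))))"

context symmetric_banach_function_space
begin

lemma step_props:
  assumes x: "x \<in> E" and h: "h > 0"
  shows "step x h \<in> E" "cmod (step x h t) \<le> cmod (x t)"
    "cmod (of_real (cmod (x t)) - step x h t) \<le> min h (cmod (x t))"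
proof -
  have b: "h * real (level h (cmod (x t))) \<le> cmod (x t)"
    "cmod (x t) - h * real (level h (cmod (x t))) \<le> h" for t
    using level_bounds[OF h norm_ge_zero[of "x t"]] by auto
  show le: "cmod (step x h t) \<le> cmod (x t)" for t
    unfolding step_def norm_of_real using b[of t] h by simp
  have [measurable]: "x \<in> borel_measurable half_line" by (rule measurable[OF x])
  show "step x h \<in> E"
    by (rule norm_mono(1)[OF x _ le]) (unfold step_def, measurable)
  have "cmod (of_real (cmod (x t)) - step x h t) = \<bar>cmod (x t) - h * real (level h (cmod (x t)))\<bar>"
    unfolding step_def by (simp flip: of_real_diff of_real_mult)
  moreover have "0 \<le> h * real (level h (cmod (x t)))" using h by simp
  ultimately show "cmod (of_real (cmod (x t)) - step x h t) \<le> min h (cmod (x t))"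
    using b[of t] by auto
qed

end

context lower_estimate_space
begin

text \<open>The error is at most min h |x|. The bound h is used on a set of finite measure, the
  bound |x| outside it, where truncation makes \<open>x\<close> small in norm.\<close>

lemma norm_cut_step_tendsto:
  assumes x: "x \<in> E" and A: "A \<in> sets lebesgue"
  shows "(\<lambda>m. N (cut (step x (1 / Suc m)) A)) \<longlonglongrightarrow> N (cut x A)"
proof -
  define v where "v t = complex_of_real (cmod (x t))" for t
  have [measurable]: "x \<in> borel_measurable half_line" by (rule measurable[OF x])
  have v: "v \<in> E" unfolding v_def by (rule norm_mono(1)[OF x]) auto
  let ?s = "\<lambda>m. step x (1 / Suc m)"
  have s: "?s m \<in> E" for m by (rule step_props(1)[OF x]) simp
  have vs: "(\<lambda>t. v t - ?s m t) \<in> E" for m by (rule minus_closed[OF v s])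
  have "N (cut v A) = N (cut x A)"
    using norm_mono(2)[OF cut_mem[OF x A] measurable[OF cut_mem[OF v A]]]
      norm_mono(2)[OF cut_mem[OF v A] measurable[OF cut_mem[OF x A]]]
    by (intro antisym) (auto simp: cut_def v_def)
  have bound: "cmod (v t - ?s m t) \<le> min (1 / Suc m) (cmod (x t))" for t m
    unfolding v_def by (rule step_props(3)[OF x]) simp
  have lim: "(\<lambda>m. N (\<lambda>t. v t - ?s m t)) \<longlonglongrightarrow> 0"
  proof (rule LIMSEQ_I)
    fix e :: real assume "e > 0"
    obtain B M where B: "B \<in> sets half_line" "emeasure half_line B < \<infinity>" and tail: "N (cut x (- B)) < e / 2"
      using truncation[OF est _ x, of "e / 2"] q \<open>e > 0\<close> by (metis half_gt_zero less_trans zero_less_one)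
    have BL: "B \<in> sets lebesgue" "- B \<in> sets lebesgue"
      using sets_half_line_lebesgue[OF B(1)] by (auto simp: Compl_in_sets_lebesgue)
    define c where "c = N (cut (\<lambda>_. 1) B)"
    have "c \<ge> 0" unfolding c_def by (rule norm_nonneg[OF indicator_mem[OF B]])
    obtain K where K: "2 * c / e < real K" using reals_Archimedean2 by blast
    have "N (\<lambda>t. v t - ?s m t) < e" if "m \<ge> K" for m
    proof -
      have "N (\<lambda>t. v t - ?s m t) \<le> N (cut (\<lambda>t. v t - ?s m t) B) + N (cut (\<lambda>t. v t - ?s m t) (- B))"
        by (rule norm_cut_split[OF vs BL(1)])
      also have "N (cut (\<lambda>t. v t - ?s m t) B) \<le> 1 / Suc m * c"
        unfolding c_def using bound by (intro norm_cut_bounded vs B) auto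
      also have "N (cut (\<lambda>t. v t - ?s m t) (- B)) \<le> N (cut x (- B))"
        using bound measurable[OF cut_mem[OF vs BL(2)]]
        by (intro norm_mono(2)[OF cut_mem[OF x BL(2)]]) (auto simp: cut_def)
      also have "1 / Suc m * c \<le> e / 2"
      proof -
        have "2 * c / e < real (Suc m)" using K that by linarith
        then show ?thesis using \<open>e > 0\<close> by (simp add: field_simps)
      qed
      finally show ?thesis using tail by simp
    qed
    then show "\<exists>K. \<forall>m\<ge>K. norm (N (\<lambda>t. v t - ?s m t) - 0) < e"
      using norm_nonneg[OF vs] by auto
  qed
  have upper: "N (cut (?s m) A) \<le> N (cut x A)" for m
    using step_props(2)[OF x] measurable[OF cut_mem[OF s A]]
    by (intro norm_mono(2)[OF cut_mem[OF x A]]) (auto simp: cut_def)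
  have lower: "N (cut x A) - N (\<lambda>t. v t - ?s m t) \<le> N (cut (?s m) A)" for m
  proof -
    have "(\<lambda>t. cut v A t - cut (?s m) A t) = cut (\<lambda>t. v t - ?s m t) A" by (auto simp: cut_def)
    then have "N (cut v A) \<le> N (cut (?s m) A) + N (cut (\<lambda>t. v t - ?s m t) A)"
      using norm_le_diff[OF cut_mem[OF v A] cut_mem[OF s A], of m] by simp
    then show ?thesis
      using norm_cut_le[OF vs A, of m] \<open>N (cut v A) = N (cut x A)\<close> by simp
  qed
  show ?thesis
  proof (rule tendsto_sandwich)
    show "(\<lambda>m. N (cut x A) - N (\<lambda>t. v t - ?s m t)) \<longlonglongrightarrow> N (cut x A)"
      using tendsto_diff[OF tendsto_const lim] by simp
  qed (use upper lower in auto)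
qed

text \<open>For j > 0 the j-th level sets of \<open>x\<close> and \<open>y\<close> have the same
  finite measure. The measures of the parts A i \<inter> L x j are therefore realised by disjoint
  subsets of \<open>L y j\<close>, and gluing over j gives sets on which the step functions are
  equimeasurable.\<close>

lemma equimeasurable_partition:
  fixes n :: nat
  assumes x: "x \<in> E" and y: "y \<in> E"
    and eq: "\<And>s. 0 \<le> s \<Longrightarrow> distribution_function x s = distribution_function y s"
    and A: "\<And>i. i < n \<Longrightarrow> A i \<in> sets lebesgue" "disjoint_family_on A {..<n}" and h: "h > 0"
  obtains B where "\<And>i. i < n \<Longrightarrow> B i \<in> sets lebesgue" "disjoint_family_on B {..<n}"
    "\<And>i. i < n \<Longrightarrow> N (cut (step x h) (A i)) = N (cut (step y h) (B i))"
proof -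
  define L where "L z j = {t \<in> space half_line. level h (cmod (z t)) = j}" for z :: "real \<Rightarrow> complex" and j
  have L: "L z j \<in> sets half_line" if "z \<in> E" for z j
  proof -
    have [measurable]: "z \<in> borel_measurable half_line" by (rule measurable[OF that])
    show ?thesis unfolding L_def by measurable
  qed
  have L_emeasure: "emeasure half_line (L z j) = distribution_function z (h * real j) - distribution_function z (h * (real j + 1))"
    and L_finite: "emeasure half_line (L z j) < \<infinity>" if z: "z \<in> E" and j: "j > 0" for z j
  proof -
    let ?S = "\<lambda>s. {t \<in> space half_line. s < cmod (z t)}"
    have S: "?S s \<in> sets half_line" for s using superlevel_set_measurable[OF measurable[OF z]] by simp
    have fin: "emeasure half_line (?S s) < \<infinity>" if "s > 0" for s
      using distribution_function_finite[OF est _ z that] q by (simp add: distribution_function_def)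
    have L_eq: "L z j = ?S (h * real j) - ?S (h * (real j + 1))"
      unfolding L_def level_eq_iff[OF h j] by (auto simp only: not_less)
    have less: "h * real j < h * (real j + 1)" and pos: "h * (real j + 1) > 0" using h by simp_all
    show "emeasure half_line (L z j) = distribution_function z (h * real j) - distribution_function z (h * (real j + 1))"
      unfolding distribution_function_def L_eq
    proof (rule emeasure_Diff)
      show "emeasure half_line (?S (h * (real j + 1))) \<noteq> \<infinity>" using fin[OF pos] by simp
      show "?S (h * (real j + 1)) \<subseteq> ?S (h * real j)" using less by (intro Collect_mono) auto
    qed (rule S)+
    have "emeasure half_line (L z j) \<le> emeasure half_line (?S (h * real j))"
      unfolding L_eq by (intro emeasure_mono S) blast
    then show "emeasure half_line (L z j) < \<infinity>" using fin[of "h * real j"] h j by (auto simp: le_less_trans)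
  qed
  have LA: "L x j \<inter> A i \<in> sets half_line" if "i < n" for i j
  proof -
    have "L x j \<in> sets lebesgue" "L x j \<subseteq> {0..}"
      using sets_half_line_lebesgue[OF L[OF x]] by (auto simp: L_def)
    then show ?thesis using A(1)[OF that] by (auto simp: sets_restrict_space_iff)
  qed
  have "\<exists>B. (\<forall>i<n. B i \<in> sets half_line \<and> B i \<subseteq> L y j \<and>
      measure half_line (B i) = measure half_line (L x j \<inter> A i)) \<and> disjoint_family_on B {..<n}" if j: "j > 0" for j
  proof (rule half_line_disjoint_subsets_of_measure[OF L[OF y] L_finite[OF y j],
        where a = "\<lambda>i. measure half_line (L x j \<inter> A i)"])
    have xf: "L x j \<in> fmeasurable half_line" using L[OF x] L_finite[OF x j] by (simp add: fmeasurable_def)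
    have "(\<Sum>i<n. measure half_line (L x j \<inter> A i)) = measure half_line (\<Union>i<n. L x j \<inter> A i)"
    proof (rule measure_finite_Union[symmetric])
      show "disjoint_family_on (\<lambda>i. L x j \<inter> A i) {..<n}"
        using A(2) unfolding disjoint_family_on_def by blast
      show "emeasure half_line (L x j \<inter> A i) \<noteq> \<infinity>" for i
        using emeasure_mono[of "L x j \<inter> A i" "L x j" half_line, OF _ L[OF x]] L_finite[OF x j]
        by (auto simp: top_unique)
    qed (use LA in auto)
    also have "\<dots> \<le> measure half_line (L x j)"
      using LA by (intro measure_mono_fmeasurable xf sets.finite_UN) auto
    also have "measure half_line (L x j) = measure half_line (L y j)"
      using L_emeasure[OF x j] L_emeasure[OF y j] eq h by (simp add: measure_def)
    finally show "(\<Sum>i<n. measure half_line (L x j \<inter> A i)) \<le> measure half_line (L y j)" .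
  qed simp
  then obtain B where B: "\<And>i j. j > 0 \<Longrightarrow> i < n \<Longrightarrow> B j i \<in> sets half_line"
    "\<And>i j. j > 0 \<Longrightarrow> i < n \<Longrightarrow> B j i \<subseteq> L y j"
    "\<And>i j. j > 0 \<Longrightarrow> i < n \<Longrightarrow> measure half_line (B j i) = measure half_line (L x j \<inter> A i)"
    "\<And>j. j > 0 \<Longrightarrow> disjoint_family_on (B j) {..<n}"
    by metis
  \<comment> \<open>Level 0 is left out: the step functions vanish there, and its measure may be
    infinite.\<close>
  define B' where "B' i = (\<Union>j\<in>{0<..}. B j i)" for i
  have B': "B' i \<in> sets half_line" if "i < n" for i
    unfolding B'_def using B(1) that by (intro sets.countable_UN') auto
  have B'_L: "B' i \<inter> L y j = B j i" if "i < n" "j > 0" for i j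
  proof (intro equalityI subsetI)
    fix t assume t: "t \<in> B' i \<inter> L y j"
    then obtain k where k: "k > 0" "t \<in> B k i" by (auto simp: B'_def)
    then have "t \<in> L y k" using B(2) that(1) by blast
    then have "k = j" using t by (simp add: L_def)
    then show "t \<in> B j i" using k by simp
  next
    fix t assume "t \<in> B j i"
    then show "t \<in> B' i \<inter> L y j" using B(2)[OF that(2,1)] that(2) by (auto simp: B'_def)
  qed
  \<comment> \<open>The set where the restricted step function exceeds s is the disjoint union of
    its levels with h j > s. Since s \<ge> 0, level 0 never counts, so equal measures for j > 0
    suffice below.\<close>
  have distr: "distribution_function (cut (step z h) D) s =
      (\<Sum>j. emeasure half_line (if h * real j > s then L z j \<inter> D else {}))"
    if z: "z \<in> E" and D: "\<And>j. j > 0 \<Longrightarrow> L z j \<inter> D \<in> sets half_line" and s: "0 \<le> s" for z D s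
  proof -
    let ?F = "\<lambda>j. if h * real j > s then L z j \<inter> D else {}"
    have "?F j \<in> sets half_line" for j
      using D[of j] h s by (cases "j = 0") auto
    then have F: "range ?F \<subseteq> sets half_line" by blast
    have "disjoint_family ?F" by (auto simp: disjoint_family_on_def L_def)
    with F have "(\<Sum>j. emeasure half_line (?F j)) = emeasure half_line (\<Union>j. ?F j)"
      by (rule suminf_emeasure)
    also have "(\<Union>j. ?F j) = {u \<in> space half_line. s < cmod (cut (step z h) D u)}"
      using s h by (auto simp: L_def cut_def step_def norm_mult split: if_splits)
    finally show ?thesis by (simp add: distribution_function_def)
  qed
  show thesis
  proof (rule that[of B'])
    show BL: "B' i \<in> sets lebesgue" if "i < n" for i by (rule sets_half_line_lebesgue[OF B'[OF that]])
    show "disjoint_family_on B' {..<n}"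
      unfolding disjoint_family_on_def
    proof (intro ballI impI)
      fix i k assume ik: "i \<in> {..<n}" "k \<in> {..<n}" "i \<noteq> k"
      show "B' i \<inter> B' k = {}"
      proof (rule ccontr)
        assume "B' i \<inter> B' k \<noteq> {}"
        then obtain t j j' where t: "j > 0" "t \<in> B j i" "j' > 0" "t \<in> B j' k" by (auto simp: B'_def)
        then have "t \<in> L y j" "t \<in> L y j'" using B(2) ik by auto
        then have "j = j'" by (simp add: L_def)
        then show False using B(4)[OF t(1)] t ik unfolding disjoint_family_on_def by blast
      qed
    qed
    fix i assume i: "i < n"
    show "N (cut (step x h) (A i)) = N (cut (step y h) (B' i))"
    proof (rule equimeasurable(2))
      show "cut (step y h) (B' i) \<in> E" by (intro cut_mem step_props y h BL i)
      show "cut (step x h) (A i) \<in> borel_measurable half_line"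
        by (intro measurable cut_mem step_props x h A i)
      fix s :: real assume s: "0 \<le> s"
      have "emeasure half_line (L x j \<inter> A i) = emeasure half_line (L y j \<inter> B' i)" if j: "j > 0" for j
      proof -
        have "emeasure half_line (B j i) < \<infinity>"
          using emeasure_mono[OF B(2)[OF j i] L[OF y]] L_finite[OF y j] by (rule le_less_trans)
        moreover have "emeasure half_line (L x j \<inter> A i) < \<infinity>"
          using emeasure_mono[of "L x j \<inter> A i" "L x j" half_line, OF _ L[OF x]] L_finite[OF x j] by (auto simp: le_less_trans)
        ultimately have "emeasure half_line (L x j \<inter> A i) = emeasure half_line (B j i)"
          using B(3)[OF j i] by (simp add: emeasure_eq_ennreal_measure)
        then show ?thesis using B'_L[OF i j] by (simp add: Int_commute)
      qed
      then have "(\<lambda>j. emeasure half_line (if h * real j > s then L x j \<inter> A i else {})) =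
          (\<lambda>j. emeasure half_line (if h * real j > s then L y j \<inter> B' i else {}))"
        using s h by (auto simp: fun_eq_iff) (metis gr_zeroI mult_zero_right not_less of_nat_0)
      moreover have "L y j \<inter> B' i \<in> sets half_line" for j using L[OF y] B'[OF i] by simp
      ultimately show "distribution_function (cut (step x h) (A i)) s = distribution_function (cut (step y h) (B' i)) s"
        using distr[OF x LA[OF i] s] distr[OF y _ s, of "B' i"] by simp
    qed
  qed
qed

text \<open>The copied family \<open>B\<close> changes with the mesh 1/(m+1) of the step functions,
  but its block sum is always bounded by the same \<open>renorm N q y\<close>, so the limit m
  \<rightarrow> \<infinity> can be taken. Exchanging the roles of \<open>x\<close> and
  \<open>y\<close> gives equality.\<close>

lemma renorm_equimeasurable_le:
  assumes x: "x \<in> E" and y: "y \<in> E"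
    and eq: "\<And>s. 0 \<le> s \<Longrightarrow> distribution_function x s = distribution_function y s"
  shows "renorm N q x \<le> renorm N q y"
proof (rule renorm_le[OF x renorm_nonneg])
  fix n :: nat and A :: "nat \<Rightarrow> real set"
  assume A: "\<And>i. i < n \<Longrightarrow> A i \<in> sets lebesgue" "disjoint_family_on A {..<n}"
  have lim: "(\<lambda>m. \<Sum>i<n. N (cut (step x (1 / Suc m)) (A i)) powr q) \<longlonglongrightarrow> (\<Sum>i<n. N (cut x (A i)) powr q)"
  proof (intro tendsto_sum)
    fix i assume "i \<in> {..<n}"
    then have Ai: "A i \<in> sets lebesgue" using A(1) by simp
    have "step x (1 / Suc m) \<in> E" for m by (rule step_props(1)[OF x]) simp
    then have "N (cut (step x (1 / Suc m)) (A i)) \<ge> 0" for m using Ai by (intro norm_nonneg cut_mem)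
    then show "(\<lambda>m. N (cut (step x (1 / Suc m)) (A i)) powr q) \<longlonglongrightarrow> N (cut x (A i)) powr q"
      using q by (intro tendsto_powr2 norm_cut_step_tendsto[OF x Ai] tendsto_const) auto
  qed
  show "(\<Sum>i<n. N (cut x (A i)) powr q) \<le> renorm N q y powr q"
  proof (rule LIMSEQ_le_const2[OF lim], intro exI[of _ 0] allI impI)
    fix m :: nat
    have h: "1 / real (Suc m) > 0" by simp
    obtain B where B: "\<And>i. i < n \<Longrightarrow> B i \<in> sets lebesgue" "disjoint_family_on B {..<n}"
      and eqN: "\<And>i. i < n \<Longrightarrow> N (cut (step x (1 / Suc m)) (A i)) = N (cut (step y (1 / Suc m)) (B i))"
      by (rule equimeasurable_partition[OF x y eq A h]) (assumption | rule that)+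
    have sy: "step y (1 / Suc m) \<in> E" by (rule step_props(1)[OF y h])
    have "(\<Sum>i<n. N (cut (step x (1 / Suc m)) (A i)) powr q) \<le> (\<Sum>i<n. N (cut y (B i)) powr q)"
    proof (rule sum_mono)
      fix i assume "i \<in> {..<n}"
      then have i: "i < n" by simp
      have "N (cut (step y (1 / Suc m)) (B i)) \<le> N (cut y (B i))"
        using step_props(2)[OF y h] measurable[OF cut_mem[OF sy B(1)[OF i]]]
        by (intro norm_mono(2)[OF cut_mem[OF y B(1)[OF i]]]) (auto simp: cut_def)
      then show "N (cut (step x (1 / Suc m)) (A i)) powr q \<le> N (cut y (B i)) powr q"
        unfolding eqN[OF i] using q norm_nonneg[OF cut_mem[OF sy B(1)[OF i]]] by (intro powr_mono2) auto
    qed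
    also have "\<dots> \<le> renorm N q y powr q" by (rule renorm_upper[OF y B])
    finally show "(\<Sum>i<n. N (cut (step x (1 / Suc m)) (A i)) powr q) \<le> renorm N q y powr q" .
  qed
qed

lemma symmetric_banach_function_space_renorm: "symmetric_banach_function_space E (renorm N q)"
proof
  fix x assume x: "x \<in> E"
  show "x \<in> borel_measurable half_line" by (rule measurable[OF x])
  show "(\<lambda>t. c * x t) \<in> E" for c by (rule scale_closed[OF x])
  show "0 \<le> renorm N q x" by (rule renorm_nonneg)
  show "renorm N q x = 0 \<longleftrightarrow> (AE t in half_line. x t = 0)"
    using norm_le_renorm[OF x] renorm_le_norm[OF x] norm_nonneg[OF x] renorm_nonneg[of x]
    unfolding norm_eq_0_iff[OF x, symmetric] by auto
  show "renorm N q (\<lambda>t. c * x t) = cmod c * renorm N q x" for c by (rule renorm_scale[OF x])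
  fix y
  show "y \<in> E \<and> renorm N q y \<le> renorm N q x"
    if "y \<in> borel_measurable half_line" "AE t in half_line. cmod (y t) \<le> cmod (x t)"
    using ideal[OF x that] renorm_mono[OF x _ that(2)] by simp
  show "y \<in> E \<and> renorm N q y = renorm N q x"
    if my: "y \<in> borel_measurable half_line" and eq: "\<And>t. 0 \<le> t \<Longrightarrow> decr_rearr y t = decr_rearr x t"
  proof -
    have y: "y \<in> E" using symmetric[OF x my eq] by simp
    have "distribution_function y s = distribution_function x s" if "0 \<le> s" for s
      using decr_rearr_eq_iff[OF my measurable[OF x]] eq that by blast
    then show ?thesis
      using renorm_equimeasurable_le[OF x y] renorm_equimeasurable_le[OF y x] y by simp
  qed
  assume y: "y \<in> E"
  show "(\<lambda>t. x t + y t) \<in> E" by (rule add_closed[OF x y])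
  show "renorm N q (\<lambda>t. x t + y t) \<le> renorm N q x + renorm N q y" by (rule renorm_triangle[OF x y])
next
  fix X :: "nat \<Rightarrow> real \<Rightarrow> complex"
  assume X: "\<And>n. X n \<in> E"
    and cauchy: "\<And>e. e > 0 \<Longrightarrow> \<exists>K. \<forall>m\<ge>K. \<forall>n\<ge>K. renorm N q (\<lambda>t. X m t - X n t) < e"
  have cauchy_N: "\<exists>K. \<forall>m\<ge>K. \<forall>n\<ge>K. N (\<lambda>t. X m t - X n t) < e" if e: "e > 0" for e
  proof -
    obtain K where K: "\<And>m n. m \<ge> K \<Longrightarrow> n \<ge> K \<Longrightarrow> renorm N q (\<lambda>t. X m t - X n t) < e"
      using cauchy[OF e] by blast
    show ?thesis
      using le_less_trans[OF norm_le_renorm[OF minus_closed[OF X X]] K] by blast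
  qed
  obtain x where x: "x \<in> E" and lim: "(\<lambda>n. N (\<lambda>t. X n t - x t)) \<longlonglongrightarrow> 0"
    using complete[OF X cauchy_N] by auto
  have "(\<lambda>n. C powr (1 / q) * N (\<lambda>t. X n t - x t)) \<longlonglongrightarrow> 0"
    using tendsto_mult_left[OF lim, of "C powr (1 / q)"] by simp
  then have "(\<lambda>n. renorm N q (\<lambda>t. X n t - x t)) \<longlonglongrightarrow> 0"
    by (rule tendsto_sandwich[OF always_eventually always_eventually tendsto_const, rotated 2])
      (intro allI renorm_nonneg renorm_le_norm[OF minus_closed[OF X x]])+
  with x show "\<exists>x\<in>E. (\<lambda>n. renorm N q (\<lambda>t. X n t - x t)) \<longlonglongrightarrow> 0" by blast
qed (rule simple_mem)

text \<open>Two estimates for the new norm are combined: the one transferred by equivalence, for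
  order continuity, and \<open>renorm_split\<close> with constant 1.\<close>

lemma uniform_Kadec_Klee_Huff_renorm: "uniform_Kadec_Klee_Huff E (renorm N q)"
proof -
  interpret R: symmetric_banach_function_space E "renorm N q"
    by (rule symmetric_banach_function_space_renorm)
  obtain C' where C': "lower_set_estimate E (renorm N q) q C'"
    using lower_set_estimate_equivalent[OF symmetric_banach_function_space_axioms
      R.symmetric_banach_function_space_axioms equivalent_norms_renorm est C] q by auto
  show ?thesis by (rule R.uniform_Kadec_Klee_Huff_if_split[OF C' q renorm_split])
qed

end

subsection \<open>Spreading functions over the half line\<close>

text \<open>Shuffling along an injection \<open>c\<close> moves the unit interval \<open>[k, k + 1)\<close> to \<open>[c k, c k + 1)\<close>
  by translation; shuffles along injections with disjoint ranges have disjoint supports.\<close>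

definition shuffle_set :: "(nat \<Rightarrow> nat) \<Rightarrow> real set \<Rightarrow> real set" where
  "shuffle_set c S = (\<Union>k. (\<lambda>t. t + (real (c k) - real k)) ` (S \<inter> {real k..<real k + 1}))"

definition shuffle :: "(nat \<Rightarrow> nat) \<Rightarrow> (real \<Rightarrow> complex) \<Rightarrow> real \<Rightarrow> complex" where
  "shuffle c x t = (if t \<in> shuffle_set c {0..} then x (t - real (nat \<lfloor>t\<rfloor>) + real (inv c (nat \<lfloor>t\<rfloor>))) else 0)"

lemma shuffle_set_iff:
  "t \<in> shuffle_set c S \<longleftrightarrow> (\<exists>k. real (c k) \<le> t \<and> t < real (c k) + 1 \<and> t - real (c k) + real k \<in> S)"
proof
  assume "t \<in> shuffle_set c S"
  then obtain k u where u: "u \<in> S" "real k \<le> u" "u < real k + 1" "t = u + (real (c k) - real k)"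
    by (auto simp: shuffle_set_def)
  then show "\<exists>k. real (c k) \<le> t \<and> t < real (c k) + 1 \<and> t - real (c k) + real k \<in> S"
    by (intro exI[of _ k]) simp
next
  assume "\<exists>k. real (c k) \<le> t \<and> t < real (c k) + 1 \<and> t - real (c k) + real k \<in> S"
  then obtain k where k: "real (c k) \<le> t" "t < real (c k) + 1" "t - real (c k) + real k \<in> S" by blast
  have "t = (t - real (c k) + real k) + (real (c k) - real k)" by simp
  moreover have "t - real (c k) + real k \<in> S \<inter> {real k..<real k + 1}" using k by simp
  ultimately show "t \<in> shuffle_set c S" unfolding shuffle_set_def by blast
qed

lemma shuffle_eq:
  assumes "inj c" "real (c k) \<le> t" "t < real (c k) + 1"
  shows "t \<in> shuffle_set c {0..}" "shuffle c x t = x (t - real (c k) + real k)"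
proof -
  show 1: "t \<in> shuffle_set c {0..}" unfolding shuffle_set_iff using assms by (intro exI[of _ k]) auto
  have "nat \<lfloor>t\<rfloor> = c k" using assms by linarith
  then show "shuffle c x t = x (t - real (c k) + real k)"
    using 1 assms(1) by (simp add: shuffle_def inv_f_f)
qed

text \<open>A shuffle is 0 off its support, so points outside are excluded exactly because V does
  not contain 0.\<close>

lemma shuffle_vimage:
  assumes "inj c" "0 \<notin> V"
  shows "{t \<in> space half_line. shuffle c x t \<in> V} = shuffle_set c {t \<in> space half_line. x t \<in> V}"
proof (intro equalityI subsetI)
  fix t assume t: "t \<in> {t \<in> space half_line. shuffle c x t \<in> V}"
  then have "t \<in> shuffle_set c {0..}" using assms(2) by (auto simp: shuffle_def split: if_splits)
  then obtain k where k: "real (c k) \<le> t" "t < real (c k) + 1" "t - real (c k) + real k \<ge> 0"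
    unfolding shuffle_set_iff by auto
  then show "t \<in> shuffle_set c {t \<in> space half_line. x t \<in> V}"
    using t shuffle_eq(2)[OF assms(1) k(1,2), of x] unfolding shuffle_set_iff by (intro exI[of _ k]) auto
next
  fix t assume "t \<in> shuffle_set c {t \<in> space half_line. x t \<in> V}"
  then obtain k where k: "real (c k) \<le> t" "t < real (c k) + 1" "x (t - real (c k) + real k) \<in> V"
    unfolding shuffle_set_iff by auto
  moreover have "0 \<le> t" using k(1) of_nat_0_le_iff order_trans by blast
  ultimately show "t \<in> {t \<in> space half_line. shuffle c x t \<in> V}"
    using shuffle_eq(2)[OF assms(1) k(1,2), of x] by simp
qed

text \<open>Translation invariance on each unit interval, then countable additivity; injectivity of
  \<open>c\<close> keeps the translated pieces disjoint.\<close>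

lemma shuffle_set_measure:
  assumes c: "inj c" and S: "S \<in> sets half_line"
  shows "shuffle_set c S \<in> sets half_line" "emeasure half_line (shuffle_set c S) = emeasure half_line S"
proof -
  have SL: "S \<in> sets lebesgue" and S0: "S \<subseteq> {0..}"
    using sets_half_line_lebesgue[OF S] sets.sets_into_space[OF S] by auto
  define U where "U k = S \<inter> {real k..<real k + 1}" for k
  define P where "P k = (\<lambda>t. 1 *\<^sub>R t + (real (c k) - real k)) ` U k" for k
  have eq: "shuffle_set c S = (\<Union>k. P k)" by (simp add: shuffle_set_def P_def U_def)
  have UL: "U k \<in> sets lebesgue" for k using SL unfolding U_def by (intro sets.Int) auto
  have "P k = (\<lambda>t. (real (c k) - real k) + t) ` U k" for k by (simp add: P_def add.commute)
  then have PL: "P k \<in> sets lebesgue" for k using lebesgue_sets_translation[OF UL] by simp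
  have P0: "P k \<subseteq> {real (c k)..<real (c k) + 1}" for k by (auto simp: P_def U_def)
  have Pm: "P k \<in> sets half_line" for k
  proof -
    have "P k \<subseteq> {0..}" using P0[of k] by (rule order_trans) auto
    then show ?thesis using PL by (simp add: sets_restrict_space_iff)
  qed
  have Um: "U k \<in> sets half_line" for k
    using UL S0 by (auto simp: sets_restrict_space_iff U_def)
  show 1: "shuffle_set c S \<in> sets half_line" unfolding eq using Pm by blast
  have disjP: "disjoint_family P"
    unfolding disjoint_family_on_def
  proof (intro ballI impI)
    fix k l :: nat assume "k \<noteq> l"
    then have "c k \<noteq> c l" using c by (auto dest: injD)
    then have "real (c k) + 1 \<le> real (c l) \<or> real (c l) + 1 \<le> real (c k)" by linarith
    then show "P k \<inter> P l = {}" using P0[of k] P0[of l] by fastforce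
  qed
  have disjU: "disjoint_family U"
    unfolding disjoint_family_on_def
  proof (intro ballI impI)
    fix k l :: nat assume "k \<noteq> l"
    then have "real k + 1 \<le> real l \<or> real l + 1 \<le> real k" by linarith
    then show "U k \<inter> U l = {}" by (auto simp: U_def)
  qed
  have S_eq: "S = (\<Union>k. U k)"
  proof (intro equalityI subsetI)
    fix t assume "t \<in> S"
    then have "t \<in> U (nat \<lfloor>t\<rfloor>)" using S0 unfolding U_def by (auto; linarith)
    then show "t \<in> (\<Union>k. U k)" by blast
  qed (auto simp: U_def)
  have "emeasure half_line (P k) = emeasure half_line (U k)" for k
  proof -
    have "emeasure half_line (P k) = emeasure lebesgue (P k)"
      using Pm[of k] sets.sets_into_space[OF Pm[of k]] by (subst emeasure_restrict_space) auto
    also have "\<dots> = emeasure lebesgue (U k)" unfolding P_def by (subst emeasure_lebesgue_affine) simp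
    also have "\<dots> = emeasure half_line (U k)"
      using sets.sets_into_space[OF Um[of k]] by (subst emeasure_restrict_space) auto
    finally show ?thesis .
  qed
  moreover have "(\<Sum>k. emeasure half_line (P k)) = emeasure half_line (shuffle_set c S)"
    unfolding eq using Pm disjP by (intro suminf_emeasure) auto
  moreover have "(\<Sum>k. emeasure half_line (U k)) = emeasure half_line S"
    using suminf_emeasure[of U half_line] Um disjU S_eq by (simp add: image_subset_iff)
  ultimately show "emeasure half_line (shuffle_set c S) = emeasure half_line S" by simp
qed

lemma shuffle_measurable:
  assumes c: "inj c" and x: "x \<in> borel_measurable half_line"
  shows "shuffle c x \<in> borel_measurable half_line"
proof (rule measurableI)
  fix V :: "complex set" assume V: "V \<in> sets borel"
  have 0: "{t \<in> space half_line. shuffle c x t \<in> V'} \<in> sets half_line" if "V' \<in> sets borel" "0 \<notin> V'" for V'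
  proof -
    have "x -` V' \<inter> space half_line \<in> sets half_line" by (rule measurable_sets[OF x that(1)])
    moreover have "x -` V' \<inter> space half_line = {t \<in> space half_line. x t \<in> V'}" by auto
    ultimately show ?thesis
      unfolding shuffle_vimage[OF c that(2)] using shuffle_set_measure(1)[OF c] by simp
  qed
  show "shuffle c x -` V \<inter> space half_line \<in> sets half_line"
  proof (cases "0 \<in> V")
    case False
    then show ?thesis using 0[OF V] by (simp add: vimage_def Int_def conj_commute)
  next
    case True
    have compl: "shuffle c x -` V \<inter> space half_line = space half_line - {t \<in> space half_line. shuffle c x t \<in> - V}"
      by auto
    show ?thesis unfolding compl by (rule sets.compl_sets[OF 0]) (use V True in auto)
  qed
qed simp

lemma distribution_function_shuffle:
  assumes c: "inj c" and x: "x \<in> borel_measurable half_line" and s: "0 \<le> s"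
  shows "distribution_function (shuffle c x) s = distribution_function x s"
proof -
  let ?V = "{z. s < cmod z}"
  have "{t \<in> space half_line. s < cmod (x t)} \<in> sets half_line"
    using superlevel_set_measurable[OF x] by simp
  then show ?thesis
    using shuffle_vimage[OF c, of ?V x] shuffle_set_measure(2)[OF c, of "{t \<in> space half_line. s < cmod (x t)}"] s
    by (simp add: distribution_function_def)
qed

lemma distribution_function_add_disjoint:
  assumes x: "x \<in> borel_measurable half_line" and y: "y \<in> borel_measurable half_line"
    and disj: "\<And>t. 0 \<le> t \<Longrightarrow> x t = 0 \<or> y t = 0" and s: "0 \<le> s"
  shows "distribution_function (\<lambda>t. x t + y t) s = distribution_function x s + distribution_function y s"
proof -
  let ?A = "\<lambda>f. {u. 0 \<le> u \<and> s < cmod (f u)}"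
  have "?A (\<lambda>t. x t + y t) = ?A x \<union> ?A y"
  proof (rule set_eqI)
    fix u show "u \<in> ?A (\<lambda>t. x t + y t) \<longleftrightarrow> u \<in> ?A x \<union> ?A y"
      using disj[of u] s by (cases "0 \<le> u") auto
  qed
  moreover have "?A x \<inter> ?A y = {}" using disj s by force
  ultimately have "emeasure half_line (?A (\<lambda>t. x t + y t)) = emeasure half_line (?A x) + emeasure half_line (?A y)"
    using superlevel_set_measurable[OF x] superlevel_set_measurable[OF y] by (simp add: plus_emeasure)
  then show ?thesis by (simp add: distribution_function_def)
qed

text \<open>Pairing splits the unit intervals into infinitely many disjoint infinite rows, each with
  room for a whole function. Every index in row n is at least n, so row n lies in [n,
  \<infinity>).\<close>

abbreviation row :: "nat \<Rightarrow> nat \<Rightarrow> nat" where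
  "row n k \<equiv> prod_encode (n, k)"

lemma inj_row: "inj (row n)"
  by (auto intro!: injI)

lemma row_disjoint:
  assumes "m \<noteq> n"
  shows "shuffle_set (row m) S \<inter> shuffle_set (row n) S' = {}"
proof (rule ccontr)
  assume "\<not> ?thesis"
  then obtain t k l where "real (row m k) \<le> t" "t < real (row m k) + 1"
    "real (row n l) \<le> t" "t < real (row n l) + 1"
    by (auto simp: shuffle_set_iff)
  then have "row m k = row n l" by linarith
  then show False using assms by simp
qed

lemma shuffle_row_eq_0: "t < real n \<Longrightarrow> shuffle (row n) x t = 0"
proof -
  assume t: "t < real n"
  have "t \<notin> shuffle_set (row n) {0..}"
  proof
    assume "t \<in> shuffle_set (row n) {0..}"
    then obtain k where "real (row n k) \<le> t" by (auto simp: shuffle_set_iff)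
    moreover have "real n \<le> real (row n k)" using le_prod_encode_1[of n k] by simp
    ultimately show False using t by simp
  qed
  then show ?thesis by (simp add: shuffle_def)
qed

section \<open>From the Kadec-Klee-Huff property to a lower estimate\<close>

context symmetric_banach_function_space
begin

lemma shuffle_mem:
  assumes "inj c" "x \<in> E"
  shows "shuffle c x \<in> E" "N (shuffle c x) = N x"
  by (rule equimeasurable[OF assms(2) shuffle_measurable[OF assms(1) measurable[OF assms(2)]]
    distribution_function_shuffle[OF assms(1) measurable[OF assms(2)]]]; assumption)+

text \<open>The functions differ only on [n, \<infinity>), and the part of a set of finite measure
  lying there tends to measure 0.\<close>

lemma tendsto_locally_in_measure_escaping:
  assumes Y: "\<And>n t. t < real n \<Longrightarrow> X n t = x t" and meas: "\<And>n. (\<lambda>t. X n t - x t) \<in> borel_measurable half_line"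
  shows "tendsto_locally_in_measure X x"
  unfolding tendsto_locally_in_measure_def
proof (intro ballI allI impI)
  fix A e assume A: "A \<in> sets half_line" "emeasure half_line A < \<infinity>" and "0 < (e::real)"
  have A': "A \<inter> {real n..} \<in> sets half_line" for n
    using A(1) by (auto simp: sets_restrict_space_iff)
  have "(\<lambda>n. emeasure half_line (A \<inter> {real n..})) \<longlonglongrightarrow> emeasure half_line (\<Inter>n. A \<inter> {real n..})"
  proof (rule Lim_emeasure_decseq)
    show "emeasure half_line (A \<inter> {real n..}) \<noteq> \<infinity>" for n
      using emeasure_mono[of "A \<inter> {real n..}" A half_line] A by (auto simp: top_unique)
  qed (use A' in \<open>auto simp: decseq_def\<close>)
  also have "(\<Inter>n. A \<inter> {real n..}) = {}"
  proof -
    have "t \<notin> (\<Inter>n. A \<inter> {real n..})" for t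
    proof -
      obtain n where "t < real n" using reals_Archimedean2 by blast
      then have "t \<notin> A \<inter> {real n..}" by simp
      then show ?thesis by blast
    qed
    then show ?thesis by blast
  qed
  finally have lim: "(\<lambda>n. emeasure half_line (A \<inter> {real n..})) \<longlonglongrightarrow> 0" by simp
  have le: "emeasure half_line {t \<in> A. e < cmod (X n t - x t)} \<le> emeasure half_line (A \<inter> {real n..})" for n
  proof (intro emeasure_mono A' subsetI)
    fix t assume t: "t \<in> {t \<in> A. e < cmod (X n t - x t)}"
    then have "\<not> t < real n" using Y[of t n] \<open>0 < e\<close> by auto
    then show "t \<in> A \<inter> {real n..}" using t by simp
  qed
  show "(\<lambda>n. emeasure half_line {t \<in> A. e < cmod (X n t - x t)}) \<longlonglongrightarrow> 0"
    by (rule tendsto_sandwich[OF _ _ tendsto_const lim]) (use le in auto)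
qed

text \<open>Everything is divided by \<open>N z\<close> to reach the unit ball. The threshold N z /
  2 for the part on Q corresponds to the separation 1/2 forbidden by the hypothesis; a part on P of
  norm above (1 - d) N z would make the limit too large.\<close>

lemma norm_drop:
  assumes d: "0 < d" "d < 1"
    and KKH: "\<And>X x. (\<And>n. X n \<in> E \<and> N (X n) \<le> 1) \<Longrightarrow> x \<in> E \<Longrightarrow> tendsto_locally_in_measure X x \<Longrightarrow>
      N x > 1 - d \<Longrightarrow> \<exists>K. \<forall>n\<ge>K. \<forall>m\<ge>K. N (\<lambda>t. X n t - X m t) \<le> 1 / 2"
    and z: "z \<in> E" and P: "P \<in> sets lebesgue" and Q: "Q \<in> sets lebesgue" and disj: "P \<inter> Q = {}"
    and large: "N (cut z Q) > N z / 2"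
  shows "N (cut z P) \<le> (1 - d) * N z"
proof (rule ccontr)
  assume "\<not> ?thesis"
  then have contra: "N (cut z P) > (1 - d) * N z" by simp
  have r: "N z > 0"
    using large norm_cut_le[OF z Q] norm_nonneg[OF z] by linarith
  let ?x = "cut z P" and ?y = "cut z Q"
  have x: "?x \<in> E" and y: "?y \<in> E" using cut_mem z P Q by auto
  \<comment> \<open>Row 0 is reserved for the fixed part; the shift by \<open>Suc\<close> keeps the
    moving part out of it.\<close>
  define w where "w n t = shuffle (row 0) ?x t + shuffle (row (Suc n)) ?y t" for n t
  have supp: "shuffle (row n) f t = 0" if "t \<notin> shuffle_set (row n) {0..}" for n f t
    using that by (simp add: shuffle_def)
  have disj_rows: "shuffle (row m) f t = 0 \<or> shuffle (row n) g t = 0" if "m \<noteq> n" for m n f g t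
    using supp row_disjoint[OF that, of "{0..}" "{0..}"] by blast
  have sx: "shuffle (row n) ?x \<in> E" and sy: "shuffle (row n) ?y \<in> E" for n
    using shuffle_mem inj_row x y by auto
  have w: "w n \<in> E" "N (w n) \<le> N z" for n
  proof -
    show wn: "w n \<in> E" unfolding w_def by (rule add_closed[OF sx sy])
    have xy: "cut z (P \<union> Q) = (\<lambda>t. ?x t + ?y t)" using disj by (auto simp: cut_def fun_eq_iff)
    have "N (w n) = N (cut z (P \<union> Q))"
    proof (rule equimeasurable)
      show "cut z (P \<union> Q) \<in> E" using z P Q by (intro cut_mem) auto
      show "w n \<in> borel_measurable half_line" by (rule measurable[OF wn])
      fix s :: real assume s: "0 \<le> s"
      have "distribution_function (w n) s =
          distribution_function (shuffle (row 0) ?x) s + distribution_function (shuffle (row (Suc n)) ?y) s"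
        unfolding w_def using disj_rows
        by (intro distribution_function_add_disjoint measurable[OF sx] measurable[OF sy] s) auto
      also have "\<dots> = distribution_function ?x s + distribution_function ?y s"
        using distribution_function_shuffle[OF inj_row] measurable x y s by simp
      also have "\<dots> = distribution_function (cut z (P \<union> Q)) s"
        unfolding xy using disj measurable[OF x] measurable[OF y] s
        by (intro distribution_function_add_disjoint[symmetric]) (auto simp: cut_def)
      finally show "distribution_function (w n) s = distribution_function (cut z (P \<union> Q)) s" .
    qed
    then show "N (w n) \<le> N z" using norm_cut_le[OF z, of "P \<union> Q"] P Q by simp
  qed
  let ?r = "complex_of_real (1 / N z)"
  define X where "X n t = ?r * w n t" for n t
  define x' where "x' t = ?r * shuffle (row 0) ?x t" for t
  have X: "X n \<in> E \<and> N (X n) \<le> 1" for n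
    using scale_closed[OF w(1), of ?r n] norm_scale[OF w(1), of ?r n] w(2)[of n] r
    by (simp add: X_def[abs_def] norm_divide)
  have x': "x' \<in> E" "N x' = N ?x / N z"
    using scale_closed[OF sx, of ?r 0] norm_scale[OF sx, of ?r 0] shuffle_mem(2)[OF inj_row x, of 0] r
    by (auto simp: x'_def[abs_def] norm_divide)
  have "tendsto_locally_in_measure X x'"
  proof (rule tendsto_locally_in_measure_escaping)
    show "X n t = x' t" if "t < real n" for n t
      using shuffle_row_eq_0[of t "Suc n"] that by (simp add: X_def x'_def w_def)
    show "(\<lambda>t. X n t - x' t) \<in> borel_measurable half_line" for n
      using minus_closed X x' measurable by blast
  qed
  moreover have "N x' > 1 - d" unfolding x'(2) using contra r by (simp add: pos_less_divide_eq)
  ultimately obtain K where K: "\<And>n m. n \<ge> K \<Longrightarrow> m \<ge> K \<Longrightarrow> N (\<lambda>t. X n t - X m t) \<le> 1 / 2"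
    using KKH[of X x', OF X x'(1)] by blast
  \<comment> \<open>In the difference of consecutive terms the part in row 0 cancels, and the two
    moving parts have disjoint supports, so the difference dominates each of them.\<close>
  have "N (\<lambda>t. ?r * shuffle (row (Suc K)) ?y t) \<le> N (\<lambda>t. X K t - X (Suc K) t)"
  proof (rule norm_mono(2))
    show "(\<lambda>t. X K t - X (Suc K) t) \<in> E" using X minus_closed by blast
    show "(\<lambda>t. ?r * shuffle (row (Suc K)) ?y t) \<in> borel_measurable half_line"
      using scale_closed[OF sy] measurable by blast
    fix t :: real
    have "shuffle (row (Suc K)) ?y t = 0 \<or> shuffle (row (Suc (Suc K))) ?y t = 0"
      by (rule disj_rows) simp
    then show "cmod (?r * shuffle (row (Suc K)) ?y t) \<le> cmod (X K t - X (Suc K) t)"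
      by (auto simp: X_def w_def algebra_simps)
  qed
  also have "\<dots> \<le> 1 / 2" using K by simp
  also have "N (\<lambda>t. ?r * shuffle (row (Suc K)) ?y t) = N ?y / N z"
    using norm_scale[OF sy, of ?r "Suc K"] shuffle_mem(2)[OF inj_row y, of "Suc K"] r
    by (simp add: norm_divide)
  finally show False using large r by (simp add: field_simps)
qed

text \<open>Suppose N z < 2 a. Each piece then has more than half of the norm of whatever remains,
  so every removal multiplies that norm by at most 1 - d. After m removals the last piece is still
  present, with norm at least a, although less than a remains: hence m + 1 pieces.\<close>

lemma double_of_disjoint:
  assumes d: "0 < d" "d < 1" "2 * (1 - d) ^ m < 1"
    and drop: "\<And>z P Q. z \<in> E \<Longrightarrow> P \<in> sets lebesgue \<Longrightarrow> Q \<in> sets lebesgue \<Longrightarrow> P \<inter> Q = {} \<Longrightarrow>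
      N (cut z Q) > N z / 2 \<Longrightarrow> N (cut z P) \<le> (1 - d) * N z"
    and z: "z \<in> E" and A: "\<And>i. i < Suc m \<Longrightarrow> A i \<in> sets lebesgue" "disjoint_family_on A {..<Suc m}"
    and large: "\<And>i. i < Suc m \<Longrightarrow> N (cut z (A i)) \<ge> a" and "a > 0"
  shows "N z \<ge> 2 * a"
proof (rule ccontr)
  assume "\<not> ?thesis"
  then have small: "N z < 2 * a" by simp
  \<comment> \<open>What is left before the i-th removal; it contains \<open>A i\<close> and every
    later piece.\<close>
  define R where "R i = - (\<Union>j<i. A j)" for i
  have R: "R i \<in> sets lebesgue" if "i \<le> Suc m" for i
    using A(1) that unfolding R_def by (intro Compl_in_sets_lebesgue[THEN iffD2] sets.finite_UN) auto
  have AR: "A i \<subseteq> R i" if "i < Suc m" for i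
  proof -
    have "A i \<inter> A j = {}" if "j < i" for j
      using disjoint_family_onD[OF A(2), of i j] that \<open>i < Suc m\<close> by simp
    then show ?thesis unfolding R_def by blast
  qed
  have "N (cut z (R i)) \<le> (1 - d) ^ i * N z" if "i \<le> m" for i
    using that
  proof (induction i)
    case 0
    then show ?case by (simp add: R_def)
  next
    case (Suc i)
    let ?y = "cut z (R i)"
    have y: "?y \<in> E" using R[of i] Suc.prems z by (intro cut_mem) auto
    have "cut ?y (A i) = cut z (A i)" using AR[of i] Suc.prems by (simp add: Int_absorb1)
    moreover have "N ?y \<le> N z" using R[of i] Suc.prems z by (intro norm_cut_le) auto
    ultimately have "N (cut ?y (A i)) > N ?y / 2" using large[of i] Suc.prems small by simp
    then have "N (cut ?y (R (Suc i))) \<le> (1 - d) * N ?y"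
      using Suc.prems R[of "Suc i"] A(1)[of i] y by (intro drop) (auto simp: R_def)
    also have "\<dots> \<le> (1 - d) * ((1 - d) ^ i * N z)"
      using Suc d by (intro mult_left_mono) auto
    also have "cut ?y (R (Suc i)) = cut z (R (Suc i))" by (auto simp: cut_def R_def)
    finally show ?case by simp
  qed
  from this[of m] have "N (cut z (R m)) \<le> (1 - d) ^ m * N z" by simp
  moreover have "a \<le> N (cut z (R m))"
    using large[of m] norm_cut_mono[OF z A(1)[of m] R[of m]] AR[of m] by force
  moreover have "(1 - d) ^ m * N z \<le> (1 - d) ^ m * (2 * a)"
    using small d by (intro mult_left_mono) auto
  moreover have "(1 - d) ^ m * (2 * a) < a" using mult_strict_right_mono[OF d(3) \<open>a > 0\<close>] by simp
  ultimately show False by simp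
qed

text \<open>The pieces are grouped into k blocks of k^j. Induction applied to \<open>z\<close>
  restricted to one block gives norm at least 2^j a, and \<open>base\<close> applied to the blocks
  gives the last factor 2.\<close>

lemma power_of_disjoint:
  fixes k :: nat
  assumes base: "\<And>z A a. z \<in> E \<Longrightarrow> (\<And>i. i < k \<Longrightarrow> A i \<in> sets lebesgue) \<Longrightarrow> disjoint_family_on A {..<k} \<Longrightarrow>
      (\<And>i. i < k \<Longrightarrow> N (cut z (A i)) \<ge> a) \<Longrightarrow> a > 0 \<Longrightarrow> N z \<ge> 2 * a"
    and "k > 0" "z \<in> E" "\<And>i. i < k ^ j \<Longrightarrow> A i \<in> sets lebesgue" "disjoint_family_on A {..<k ^ j}"
    "\<And>i. i < k ^ j \<Longrightarrow> N (cut z (A i)) \<ge> a" "a > 0"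
  shows "N z \<ge> 2 ^ j * a"
  using assms(3-)
proof (induction j arbitrary: z A)
  case 0
  have "A 0 \<in> sets lebesgue" "a \<le> N (cut z (A 0))" using 0(2)[of 0] 0(4)[of 0] by simp_all
  then show ?case using norm_cut_le[OF 0(1), of "A 0"] by simp
next
  case (Suc j)
  define M where "M = k ^ j"
  define B where "B b = (\<Union>i<M. A (b * M + i))" for b
  have idx: "b * M + i < k ^ Suc j" if "b < k" "i < M" for b i
  proof -
    have "b * M + i < Suc b * M" using that by simp
    also have "\<dots> \<le> k * M" using that by (intro mult_right_mono) auto
    finally show ?thesis by (simp add: M_def)
  qed
  have B: "B b \<in> sets lebesgue" if "b < k" for b
    using idx[OF that] Suc.prems(2) unfolding B_def by (intro sets.finite_UN) auto
  have disj: "A i \<inter> A i' = {}" if "i < k ^ Suc j" "i' < k ^ Suc j" "i \<noteq> i'" for i i'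
    using Suc.prems(3) that unfolding disjoint_family_on_def by blast
  have inj: "b = b' \<and> i = i'" if "b * M + i = b' * M + i'" "i < M" "i' < M" for b b' i i'
  proof -
    have "(b * M + i) div M = (b' * M + i') div M" "(b * M + i) mod M = (b' * M + i') mod M"
      using that(1) by simp_all
    then show ?thesis using that(2,3) by simp
  qed
  have "N z \<ge> 2 * (2 ^ j * a)"
  proof (rule base[OF Suc.prems(1), of B])
    show "disjoint_family_on B {..<k}"
      unfolding disjoint_family_on_def
    proof (intro ballI impI)
      fix b b' assume b: "b \<in> {..<k}" "b' \<in> {..<k}" "b \<noteq> b'"
      have "A (b * M + i) \<inter> A (b' * M + i') = {}" if "i < M" "i' < M" for i i'
        using b idx that inj[OF _ that, of b b'] by (intro disj) auto
      then show "B b \<inter> B b' = {}" unfolding B_def by blast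
    qed
    show "N (cut z (B b)) \<ge> 2 ^ j * a" if b: "b < k" for b
    proof (rule Suc.IH)
      show "cut z (B b) \<in> E" using Suc.prems(1) B[OF b] by (rule cut_mem)
      fix i assume i: "i < k ^ j"
      then have iM: "i < M" by (simp add: M_def)
      show "A (b * M + i) \<in> sets lebesgue" using Suc.prems(2) idx[OF b iM] by blast
      have "B b \<inter> A (b * M + i) = A (b * M + i)" using iM by (auto simp: B_def)
      then show "N (cut (cut z (B b)) (A (b * M + i))) \<ge> a" using Suc.prems(4) idx[OF b iM] by simp
    next
      show "disjoint_family_on (\<lambda>i. A (b * M + i)) {..<k ^ j}"
        unfolding disjoint_family_on_def
        using disj idx[OF b] by (auto simp: M_def)
    qed (rule Suc.prems(5))
  qed (use B \<open>a > 0\<close> in auto)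
  then show ?case by simp
qed

text \<open>Pieces with norm in (N z / 2^(j+1), N z / 2^j] number fewer than k^(j+1), and 2^q = 2 k
  turns their contribution into at most k 2^(-j) (N z)^q. Summing over j gives the constant 2
  k.\<close>

lemma lower_set_estimate_of_doubling:
  assumes base: "\<And>z A a. z \<in> E \<Longrightarrow> (\<And>i. i < k \<Longrightarrow> A i \<in> sets lebesgue) \<Longrightarrow> disjoint_family_on A {..<k} \<Longrightarrow>
      (\<And>i. i < k \<Longrightarrow> N (cut z (A i)) \<ge> a) \<Longrightarrow> a > 0 \<Longrightarrow> N z \<ge> 2 * a"
    and k: "k \<ge> 2" and q: "2 powr q = 2 * real k"
  shows "lower_set_estimate E N q (2 * real k)"
  unfolding lower_set_estimate_def
proof (intro allI impI, elim conjE)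
  fix n z and A :: "nat \<Rightarrow> real set"
  assume z: "z \<in> E" and A: "\<forall>i<n. A i \<in> sets lebesgue" and disj: "disjoint_family_on A {..<n::nat}"
  let ?a = "\<lambda>i. N (cut z (A i))"
  have a: "0 \<le> ?a i" "?a i \<le> N z" if "i < n" for i
    using A that z norm_nonneg cut_mem norm_cut_le by auto
  have "q > 0"
  proof (rule ccontr)
    assume "\<not> ?thesis"
    then have "2 powr q \<le> 2 powr 0" by (intro powr_mono) auto
    then show False using q k by simp
  qed
  show "(\<Sum>i<n. ?a i powr q) \<le> 2 * real k * N z powr q"
  proof (cases "N z = 0")
    case True
    then have "?a i = 0" if "i < n" for i using a[OF that] by simp
    then show ?thesis using True by simp
  next
    case False
    then have r: "N z > 0" using norm_nonneg[OF z] by simp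
    \<comment> \<open>Cumulative buckets: \<open>I j\<close> holds all pieces above the threshold,
      and dyadic sizes appear as differences \<open>I (Suc j) - I j\<close>.\<close>
    define I where "I j = {i \<in> {..<n}. ?a i > N z / 2 ^ j}" for j
    have cardI: "card (I j) < k ^ j" for j
    proof (rule ccontr)
      assume "\<not> ?thesis"
      then obtain T where T: "T \<subseteq> I j" "card T = k ^ j" "finite T"
        using obtain_subset_with_card_n[of "k ^ j" "I j"] by (auto simp: not_less)
      then obtain f where f: "bij_betw f {..<k ^ j} T" using ex_bij_betw_nat_finite[of T] by (auto simp: atLeast0LessThan)
      \<comment> \<open>The minimum over finitely many pieces is a common lower bound still strictly
        above N z / 2^j, so that 2^j b exceeds \<open>N z\<close>.\<close>
      define b where "b = Min (?a ` T)"
      have "T \<noteq> {}" using T(2) k by auto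
      then have b: "b > N z / 2 ^ j" "\<And>i. i \<in> T \<Longrightarrow> b \<le> ?a i"
        unfolding b_def using T(1,3) by (auto simp: I_def)
      have fT: "f i \<in> T" if "i < k ^ j" for i using f that by (auto simp: bij_betw_def)
      have T_n: "i < n" if "i \<in> T" for i using T(1) that by (auto simp: I_def)
      have "b > 0" using b(1) r by (smt (verit) divide_pos_pos zero_less_power)
      have "N z \<ge> 2 ^ j * b"
      proof (rule power_of_disjoint[where A = "\<lambda>i. A (f i)", OF base])
        show "disjoint_family_on (\<lambda>i. A (f i)) {..<k ^ j}"
          unfolding disjoint_family_on_def
        proof (intro ballI impI)
          fix i i' assume i: "i \<in> {..<k ^ j}" "i' \<in> {..<k ^ j}" "i \<noteq> i'"
          then have "f i \<noteq> f i'" using f by (auto simp: bij_betw_def inj_on_def)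
          then show "A (f i) \<inter> A (f i') = {}"
            using disj T_n fT i unfolding disjoint_family_on_def by blast
        qed
      qed (use z A k fT T_n b \<open>b > 0\<close> in auto)
      then show False using b(1) by (simp add: field_simps)
    qed
    have two: "(1 / 2 ^ j) powr q = 1 / (2 * real k) ^ j" for j :: nat
    proof -
      have "(1 / 2 ^ j) powr q = 1 / (2 powr real j) powr q" by (simp add: powr_divide powr_realpow)
      also have "(2 powr real j) powr q = (2 powr q) powr real j" by (simp add: powr_powr mult.commute)
      also have "\<dots> = (2 * real k) ^ j" unfolding q using k by (simp add: powr_realpow)
      finally show ?thesis .
    qed
    \<comment> \<open>The factor 1 - 1 / 2^j is the partial geometric sum; its increment times 2 k
      is the contribution k / 2^j of the new dyadic size.\<close>
    have "(\<Sum>i\<in>I j. ?a i powr q) \<le> 2 * real k * (1 - 1 / 2 ^ j) * N z powr q" for j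
    proof (induction j)
      case 0
      have "i \<notin> I 0" for i using a(2)[of i] by (auto simp: I_def)
      then have "I 0 = {}" by blast
      then show ?case by simp
    next
      case (Suc j)
      have fin: "finite (I l)" for l by (simp add: I_def)
      have "N z / 2 ^ Suc j \<le> N z / 2 ^ j" using r by (simp add: field_simps)
      then have sub: "I j \<subseteq> I (Suc j)" by (auto simp: I_def)
      have "(\<Sum>i\<in>I (Suc j). ?a i powr q) = (\<Sum>i\<in>I (Suc j) - I j. ?a i powr q) + (\<Sum>i\<in>I j. ?a i powr q)"
        by (rule sum.subset_diff[OF sub fin])
      also have "(\<Sum>i\<in>I (Suc j) - I j. ?a i powr q) \<le> (\<Sum>i\<in>I (Suc j) - I j. (N z * (1 / 2 ^ j)) powr q)"
        using a \<open>q > 0\<close> by (intro sum_mono powr_mono2) (auto simp: I_def not_less)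
      also have "\<dots> = real (card (I (Suc j) - I j)) * (N z powr q * (1 / (2 * real k) ^ j))"
        unfolding powr_mult two using r by (simp add: powr_mult two)
      also have "\<dots> \<le> real (k ^ Suc j) * (N z powr q * (1 / (2 * real k) ^ j))"
      proof (intro mult_right_mono)
        have "card (I (Suc j) - I j) \<le> card (I (Suc j))" by (intro card_mono fin) auto
        then show "real (card (I (Suc j) - I j)) \<le> real (k ^ Suc j)"
          using cardI[of "Suc j"] by (simp only: of_nat_le_iff)
      qed simp
      also have "\<dots> = real k * (1 / 2 ^ j) * N z powr q"
        using k by (simp add: power_mult_distrib)
      also have "real k * (1 / 2 ^ j) * N z powr q + (\<Sum>i\<in>I j. ?a i powr q) \<le>
          real k * (1 / 2 ^ j) * N z powr q + 2 * real k * (1 - 1 / 2 ^ j) * N z powr q"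
        using Suc.IH by simp
      also have "\<dots> = 2 * real k * (1 - 1 / 2 ^ Suc j) * N z powr q"
        by (simp add: field_simps)
      finally show ?case by simp
    qed
    note bucket = this
    \<comment> \<open>There are finitely many pieces, so one threshold lies below all non-zero
      norms; the sum of the individual exponents is a crude common choice.\<close>
    have "\<exists>j. \<forall>i<n. ?a i > 0 \<longrightarrow> i \<in> I j"
    proof -
      have "\<exists>j. N z / 2 ^ j < ?a i" if pos: "?a i > 0" for i
      proof -
        obtain j where "(1 / 2) ^ j < ?a i / N z"
          using real_arch_pow_inv[of "?a i / N z" "1 / 2"] pos r by auto
        then show ?thesis using r by (auto simp: field_simps power_one_over intro!: exI[of _ j])
      qed
      then obtain J where J: "\<And>i. ?a i > 0 \<Longrightarrow> N z / 2 ^ J i < ?a i" by metis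
      show ?thesis
      proof (intro exI[of _ "\<Sum>i<n. J i"] allI impI)
        fix i assume i: "i < n" "?a i > 0"
        have "J i \<le> (\<Sum>i<n. J i)" using i by (intro member_le_sum) auto
        then have "(2::real) ^ J i \<le> 2 ^ (\<Sum>i<n. J i)" by (intro power_increasing) auto
        then have "N z / 2 ^ (\<Sum>i<n. J i) \<le> N z / 2 ^ J i" using r by (intro divide_left_mono) auto
        then show "i \<in> I (\<Sum>i<n. J i)" using J[OF i(2)] i(1) by (simp add: I_def)
      qed
    qed
    then obtain j where j: "\<And>i. i < n \<Longrightarrow> ?a i > 0 \<Longrightarrow> i \<in> I j" by blast
    have "(\<Sum>i<n. ?a i powr q) = (\<Sum>i\<in>I j. ?a i powr q)"
    proof (rule sum.mono_neutral_right)
      show "\<forall>i\<in>{..<n} - I j. ?a i powr q = 0"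
      proof
        fix i assume "i \<in> {..<n} - I j"
        then have "?a i = 0" using j[of i] a(1)[of i] by fastforce
        then show "?a i powr q = 0" by simp
      qed
    qed (auto simp: I_def)
    also have "\<dots> \<le> 2 * real k * (1 - 1 / 2 ^ j) * N z powr q" by (rule bucket)
    also have "\<dots> \<le> 2 * real k * 1 * N z powr q"
      by (intro mult_right_mono mult_left_mono) auto
    finally show ?thesis by simp
  qed
qed

lemma lower_set_estimate_of_uniform_Kadec_Klee_Huff:
  assumes "uniform_Kadec_Klee_Huff E N"
  obtains q C where "q > 1" "C > 0" "lower_set_estimate E N q C"
proof -
  obtain d where d: "0 < d" "d < 1" and
    KKH: "\<forall>X x. (\<forall>n. X n \<in> E \<and> N (X n) \<le> 1) \<and> x \<in> E \<and>
           tendsto_locally_in_measure X x \<and> N x > 1 - d \<longrightarrow>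
           (\<exists>K. \<forall>n\<ge>K. \<forall>m\<ge>K. N (\<lambda>t. X n t - X m t) \<le> 1 / 2)"
    using assms[unfolded uniform_Kadec_Klee_Huff_def, rule_format, of "1 / 2"] by auto
  have drop: "N (cut z P) \<le> (1 - d) * N z"
    if "z \<in> E" "P \<in> sets lebesgue" "Q \<in> sets lebesgue" "P \<inter> Q = {}" "N (cut z Q) > N z / 2" for z P Q
  proof (rule norm_drop[OF d _ that])
    show "\<exists>K. \<forall>n\<ge>K. \<forall>m\<ge>K. N (\<lambda>t. X n t - X m t) \<le> 1 / 2"
      if "\<And>n. X n \<in> E \<and> N (X n) \<le> 1" "x \<in> E" "tendsto_locally_in_measure X x" "N x > 1 - d" for X x
      using KKH[THEN spec, THEN spec, THEN mp, of X x] that by blast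
  qed
  obtain m where "(1 - d) ^ m < 1 / 2" using real_arch_pow_inv[of "1 / 2" "1 - d"] d by auto
  then have m: "2 * (1 - d) ^ m < 1" by simp
  \<comment> \<open>For m = 0 the inequality would read 2 < 1. Hence k = m + 1 is at least 2, and q
    = log 2 (2 k) is at least 2.\<close>
  then have "m \<noteq> 0" by (cases m) auto
  define q where "q = log 2 (2 * real (Suc m))"
  have "lower_set_estimate E N q (2 * real (Suc m))"
  proof (rule lower_set_estimate_of_doubling)
    show "2 * a \<le> N z"
      if "z \<in> E" "\<And>i. i < Suc m \<Longrightarrow> A i \<in> sets lebesgue" "disjoint_family_on A {..<Suc m}"
        "\<And>i. i < Suc m \<Longrightarrow> a \<le> N (cut z (A i))" "a > 0" for z A a
      by (rule double_of_disjoint[OF d m drop that])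
    show "2 powr q = 2 * real (Suc m)" by (simp add: q_def)
  qed (use \<open>m \<noteq> 0\<close> in simp)
  moreover have "q > 1"
    unfolding q_def using \<open>m \<noteq> 0\<close> by (simp add: less_log_iff)
  ultimately show thesis by (intro that[of q "2 * real (Suc m)"]) auto
qed

end

theorem corollary2p11:
  fixes E :: "(real \<Rightarrow> complex) set" and N :: "(real \<Rightarrow> complex) \<Rightarrow> real"
  assumes "symmetric_banach_function_space E N"
  shows "(\<exists>q>1. lower_estimate E N q) \<longleftrightarrow>
    (\<exists>N0. symmetric_banach_function_space E N0 \<and> equivalent_norms E N N0 \<and>
      uniform_Kadec_Klee_Huff E N0)"
proof
  interpret symmetric_banach_function_space E N by (rule assms)
  assume "\<exists>q>1. lower_estimate E N q"
  then obtain q where q: "q > 1" and "lower_estimate E N q" by blast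
  then obtain C where "C > 0" "lower_set_estimate E N q C"
    using lower_set_estimate_imp by blast
  then interpret lower_estimate_space E N q C
    by unfold_locales (use q in auto)
  show "\<exists>N0. symmetric_banach_function_space E N0 \<and> equivalent_norms E N N0 \<and>
      uniform_Kadec_Klee_Huff E N0"
    using symmetric_banach_function_space_renorm equivalent_norms_renorm
      uniform_Kadec_Klee_Huff_renorm by blast
next
  assume "\<exists>N0. symmetric_banach_function_space E N0 \<and> equivalent_norms E N N0 \<and>
      uniform_Kadec_Klee_Huff E N0"
  then obtain N0 where N0: "symmetric_banach_function_space E N0" "equivalent_norms E N N0"
    "uniform_Kadec_Klee_Huff E N0" by blast
  obtain q C where q: "q > 1" and C: "C > 0" "lower_set_estimate E N0 q C"
    by (rule symmetric_banach_function_space.lower_set_estimate_of_uniform_Kadec_Klee_Huff[OF N0(1,3)])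
  obtain C' where "C' > 0" "lower_set_estimate E N q C'"
    using lower_set_estimate_equivalent[OF N0(1) assms equivalent_norms_sym[OF N0(2)] C(2,1)] q by auto
  with q show "\<exists>q>1. lower_estimate E N q"
    using symmetric_banach_function_space.lower_estimate_of_set[OF assms] by blast
qed

end
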